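(* (1) The family $\{(\mathbf{H}_\phi,\mathbf{NOT}_\phi):\phi\in[0,2\pi)\}$ is characterized by the following experimental equations in two variables, i.e. a pair $(\mathbf{F},\mathbf{G})$ of one-qubit CPSOs belongs to this family if and only if it satisfies all of: $\mathrm{Pr}^0[\mathbf{F}(|0\rangle\langle0|)]=\tfrac12$, $\mathrm{Pr}^0[\mathbf{F}^2(|0\rangle\langle0|)]=1$, $\mathrm{Pr}^0[\mathbf{F}^2(|1\rangle\langle1|)]=0$, $\mathrm{Pr}^0[\mathbf{G}(|0\rangle\langle0|)]=0$, $\mathrm{Pr}^0[\mathbf{G}(|1\rangle\langle1|)]=1$, $\mathrm{Pr}^0[\mathbf{F}\circ\mathbf{G}^2\circ\mathbf{F}(|0\rangle\langle0|)]=1$, $\mathrm{Pr}^0[\mathbf{F}\circ\mathbf{G}\circ\mathbf{F}(|0\rangle\langle0|)]=1$. (2) Let $\alpha\in[0,\pi]$ with $\alpha/\pi$ rational, and let $n_\alpha$ be the smallest positive integer $n$ with $n\alpha\equiv0\pmod{2\pi}$. Then the family $\mathcal{H}\times\{\mathbf{R}_\alpha,\mathbf{R}_{-\alpha}\}$ is characterized by the following experimental equations in two variables, i.e. a pair $(\mathbf{F},\mathbf{G})$ of one-qubit CPSOs belongs to this family if and only if it satisfies all of: $\mathrm{Pr}^0[\mathbf{F}(|0\rangle\langle0|)]=\tfrac12$, $\mathrm{Pr}^0[\mathbf{F}^2(|0\rangle\langle0|)]=1$, $\mathrm{Pr}^0[\mathbf{F}^2(|1\rangle\langle1|)]=0$,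 $\mathrm{Pr}^0[\mathbf{G}(|0\rangle\langle0|)]=1$, $\mathrm{Pr}^0[\mathbf{G}(|1\rangle\langle1|)]=0$, $\mathrm{Pr}^0[\mathbf{F}\circ\mathbf{G}^{n_\alpha}\circ\mathbf{F}(|0\rangle\langle0|)]=1$, $\mathrm{Pr}^0[\mathbf{F}\circ\mathbf{G}\circ\mathbf{F}(|0\rangle\langle0|)]=\tfrac12+\tfrac12\cos\alpha$.
   Context: A one-qubit density matrix is a positive semidefinite Hermitian $2\times2$ matrix of trace $1$. A one-qubit superoperator is a linear map on $\mathbb{C}^{2\times2}$; a superoperator is a PSO if it sends density matrices to density matrices; $\mathbf{G}$ is a CPSO if $\mathbf{G}\otimes\mathbf{I}_M$ is a PSO for every positive integer $M$, where $\mathbf{I}_M$ is the identity on $\mathbb{C}^{M\times M}$. $\mathrm{Pr}^0[\rho]=\langle0|\rho|0\rangle$. For a unitary $A$, $\mathbf{A}$ denotes the CPSO $\rho\mapsto A\rho A^\dagger$. For $\phi\in[0,2\pi)$: $H_\phi$ is the unitary on $\mathbb{C}^2$ with $H_\phi|0\rangle=(|0\rangle+e^{i\phi}|1\rangle)/\sqrt2$ and $H_\phi(e^{i\phi}|1\rangle)=(|0\rangle-e^{i\phi}|1\rangle)/\sqrt2$; $\mathrm{NOT}_\phi$ is the unitary with $\mathrm{NOT}_\phi|0\rangle=e^{i\phi}|1\rangle$ and $\mathrm{NOT}_\phi(e^{i\phi}|1\rangle)=|0\rangle$. $\mathcal{H}=\{\mathbf{H}_\phi:\phi\in[0,2\pi)\}$.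 $R_\alpha$ is the unitary with $R_\alpha|0\rangle=|0\rangle$ and $R_\alpha|1\rangle=e^{i\alpha}|1\rangle$. *)

theory Defs
  imports
    "HOL-Library.FuncSet"
    "HOL-Library.Real_Mod"
    "Jordan_Normal_Form.Schur_Decomposition"
begin

section \<open>Density matrices and superoperators\<close>

definition mat_trace :: "complex mat \<Rightarrow> complex" where
  "mat_trace A = (\<Sum>i<dim_row A. A $$ (i, i))"

text \<open>The order on complex numbers is the one in which \<open>0 \<le> z\<close> means that \<open>z\<close> is real and
  nonnegative.\<close>

definition density_matrix :: "nat \<Rightarrow> complex mat \<Rightarrow> bool" where
  "density_matrix n \<rho> \<longleftrightarrow>
     \<rho> \<in> carrier_mat n n \<and>
     mat_adjoint \<rho> = \<rho> \<and>
     (\<forall>v \<in> carrier_vec n. 0 \<le> (\<rho> *\<^sub>v v) \<bullet>c v) \<and>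
     mat_trace \<rho> = 1"

text \<open>Maps on \<open>n \<times> n\<close> matrices are represented by extensional functions, so that HOL equality
  of two of them is equality as maps on \<open>n \<times> n\<close> matrices.\<close>

definition superoperator :: "nat \<Rightarrow> (complex mat \<Rightarrow> complex mat) \<Rightarrow> bool" where
  "superoperator n F \<longleftrightarrow>
     F \<in> carrier_mat n n \<rightarrow>\<^sub>E carrier_mat n n \<and>
     (\<forall>A \<in> carrier_mat n n. \<forall>B \<in> carrier_mat n n. F (A + B) = F A + F B) \<and>
     (\<forall>c. \<forall>A \<in> carrier_mat n n. F (c \<cdot>\<^sub>m A) = c \<cdot>\<^sub>m F A)"

definition PSO :: "nat \<Rightarrow> (complex mat \<Rightarrow> complex mat) \<Rightarrow> bool" where
  "PSO n F \<longleftrightarrow> superoperator n F \<and> (\<forall>\<rho>. density_matrix n \<rho> \<longrightarrow> density_matrix n (F \<rho>))"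

text \<open>The basis vector \<open>e\<^sub>a \<otimes> e\<^sub>k\<close> of the tensor product of spaces of dimensions \<open>n\<close> and \<open>M\<close> has
  index \<open>a * M + k\<close>. An \<open>nM \<times> nM\<close> matrix is then the sum over \<open>k\<close> and \<open>l\<close> of
  \<open>slice n M k l X \<otimes> E\<^sub>k\<^sub>l\<close> with \<open>E\<^sub>k\<^sub>l\<close> the matrix units, and the tensor product of \<open>F\<close> with the
  identity on \<open>M \<times> M\<close> matrices applies \<open>F\<close> to each slice. The lemmas \<open>tensor_id_kron\<close> and
  \<open>superoperator_tensor_id\<close> below identify it as the linear map sending \<open>A \<otimes> B\<close> to
  \<open>F A \<otimes> B\<close>.\<close>

definition kron :: "complex mat \<Rightarrow> complex mat \<Rightarrow> complex mat" where
  "kron A B = mat (dim_row A * dim_row B) (dim_col A * dim_col B)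
     (\<lambda>(i, j). A $$ (i div dim_row B, j div dim_col B) * B $$ (i mod dim_row B, j mod dim_col B))"

definition slice :: "nat \<Rightarrow> nat \<Rightarrow> nat \<Rightarrow> nat \<Rightarrow> complex mat \<Rightarrow> complex mat" where
  "slice n M k l X = mat n n (\<lambda>(a, b). X $$ (a * M + k, b * M + l))"

definition tensor_id ::
  "nat \<Rightarrow> nat \<Rightarrow> (complex mat \<Rightarrow> complex mat) \<Rightarrow> complex mat \<Rightarrow> complex mat" where
  "tensor_id n M F = (\<lambda>X \<in> carrier_mat (n * M) (n * M).
     mat (n * M) (n * M) (\<lambda>(i, j). F (slice n M (i mod M) (j mod M) X) $$ (i div M, j div M)))"

definition CPSO :: "(complex mat \<Rightarrow> complex mat) \<Rightarrow> bool" where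
  "CPSO G \<longleftrightarrow> superoperator 2 G \<and> (\<forall>M>0. PSO (2 * M) (tensor_id 2 M G))"

section \<open>One-qubit states, measurement and gates\<close>

abbreviation ket :: "nat \<Rightarrow> complex vec" where
  "ket b \<equiv> unit_vec 2 b"

definition ketbra :: "complex vec \<Rightarrow> complex vec \<Rightarrow> complex mat" where
  "ketbra v w = mat (dim_vec v) (dim_vec w) (\<lambda>(i, j). v $ i * cnj (w $ j))"

text \<open>\<open>Pr0 \<rho>\<close> has type \<open>complex\<close>; it is real on density matrices.\<close>

definition Pr0 :: "complex mat \<Rightarrow> complex" where
  "Pr0 \<rho> = (\<rho> *\<^sub>v ket 0) \<bullet>c ket 0"

text \<open>For unitary \<open>A\<close> the map \<open>conj_superop A\<close> is a CPSO (\<open>CPSO_conj_superop\<close>).\<close>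

definition unitary_mat :: "nat \<Rightarrow> complex mat \<Rightarrow> bool" where
  "unitary_mat n A \<longleftrightarrow> A \<in> carrier_mat n n \<and> mat_adjoint A * A = 1\<^sub>m n \<and> A * mat_adjoint A = 1\<^sub>m n"

definition conj_superop :: "complex mat \<Rightarrow> complex mat \<Rightarrow> complex mat" where
  "conj_superop A = (\<lambda>\<rho> \<in> carrier_mat (dim_row A) (dim_row A). A * \<rho> * mat_adjoint A)"

text \<open>The matrices below are in the basis \<open>ket 0\<close>, \<open>ket 1\<close>. The lemmas \<open>H_gate_iff\<close>,
  \<open>NOT_gate_iff\<close> and \<open>R_gate_iff\<close> characterize them as the unitaries with the intended action
  on \<open>ket 0\<close> and \<open>ket 1\<close> or \<open>cis \<phi> \<cdot>\<^sub>v ket 1\<close>.\<close>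

definition H_gate :: "real \<Rightarrow> complex mat" where
  "H_gate \<phi> = mat_of_rows_list 2
     [[1 / sqrt 2, cis (- \<phi>) / sqrt 2],
      [cis \<phi> / sqrt 2, - 1 / sqrt 2]]"

definition NOT_gate :: "real \<Rightarrow> complex mat" where
  "NOT_gate \<phi> = mat_of_rows_list 2
     [[0, cis (- \<phi>)],
      [cis \<phi>, 0]]"

definition R_gate :: "real \<Rightarrow> complex mat" where
  "R_gate \<alpha> = mat_of_rows_list 2
     [[1, 0],
      [0, cis \<alpha>]]"

definition H_family :: "(complex mat \<Rightarrow> complex mat) set" where
  "H_family = {conj_superop (H_gate \<phi>) | \<phi>. \<phi> \<in> {0..<2 * pi}}"

definition H_NOT_family ::
  "((complex mat \<Rightarrow> complex mat) \<times> (complex mat \<Rightarrow> complex mat)) set" where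
  "H_NOT_family = {(conj_superop (H_gate \<phi>), conj_superop (NOT_gate \<phi>)) | \<phi>. \<phi> \<in> {0..<2 * pi}}"

definition rotation_order :: "real \<Rightarrow> nat" where
  "rotation_order \<alpha> = (LEAST n. n > 0 \<and> [real n * \<alpha> = 0] (rmod (2 * pi)))"

section \<open>Basic facts\<close>

lemma mat_adjoint_carrier [simp]: "A \<in> carrier_mat n m \<Longrightarrow> mat_adjoint A \<in> carrier_mat m n"
  by (auto simp: mat_adjoint_def mat_of_rows_def)

lemma mat_adjoint_index [simp]:
  "i < dim_col A \<Longrightarrow> j < dim_row A \<Longrightarrow> mat_adjoint A $$ (i, j) = cnj (A $$ (j, i))"
  for A :: "complex mat"
  by (simp add: mat_adjoint_def mat_of_rows_index)

lemma mat_adjoint_dim [simp]: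
  "dim_row (mat_adjoint A) = dim_col A" "dim_col (mat_adjoint A) = dim_row A"
  by (auto simp: mat_adjoint_def)

lemma index_bound: "i < n * M \<Longrightarrow> i div M < n \<and> i mod M < M" for i n M :: nat
  by (metis less_mult_imp_div_less mod_less_divisor mult_0_right neq0_conv not_less_zero)

lemma index_join: "a < n \<Longrightarrow> k < M \<Longrightarrow> a * M + k < n * M" for a k n M :: nat
proof -
  assume "a < n" "k < M"
  then have "a * M + k < Suc a * M" by simp
  also have "\<dots> \<le> n * M" using \<open>a < n\<close> by (intro mult_le_mono1) simp
  finally show ?thesis .
qed

lemma slice_carrier [simp]: "slice n M k l X \<in> carrier_mat n n"
  by (simp add: slice_def)

lemma tensor_id_kron:
  assumes F: "superoperator n F"
    and A: "A \<in> carrier_mat n n" and B: "B \<in> carrier_mat M M"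
  shows "tensor_id n M F (kron A B) = kron (F A) B"
proof -
  have FA: "F A \<in> carrier_mat n n" using F A by (auto simp: superoperator_def)
  have K: "kron A B \<in> carrier_mat (n * M) (n * M)" using A B by (auto simp: kron_def)
  have sl: "slice n M k l (kron A B) = B $$ (k, l) \<cdot>\<^sub>m A" if "k < M" "l < M" for k l
    using A B that by (intro eq_matI) (auto simp: slice_def kron_def index_join)
  show ?thesis
  proof (intro eq_matI)
    fix i j
    assume "i < dim_row (kron (F A) B)" "j < dim_col (kron (F A) B)"
    then have ij: "i < n * M" "j < n * M" using FA B by (auto simp: kron_def)
    then have b: "i div M < n" "i mod M < M" "j div M < n" "j mod M < M"
      using index_bound by blast+
    have "tensor_id n M F (kron A B) $$ (i, j) = F (B $$ (i mod M, j mod M) \<cdot>\<^sub>m A) $$ (i div M, j div M)"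
      using K ij b by (simp add: tensor_id_def sl)
    also have "\<dots> = (B $$ (i mod M, j mod M) \<cdot>\<^sub>m F A) $$ (i div M, j div M)"
      using F A by (simp add: superoperator_def)
    finally show "tensor_id n M F (kron A B) $$ (i, j) = kron (F A) B $$ (i, j)"
      using FA B ij b by (simp add: kron_def)
  qed (use FA B K in \<open>auto simp: tensor_id_def kron_def\<close>)
qed

lemma superoperator_tensor_id:
  assumes F: "superoperator n F"
  shows "superoperator (n * M) (tensor_id n M F)"
proof -
  have Fc: "F A \<in> carrier_mat n n" if "A \<in> carrier_mat n n" for A
    using F that by (auto simp: superoperator_def)
  have d: "dim_row (F A) = n" "dim_col (F A) = n" if "A \<in> carrier_mat n n" for A
    using Fc[OF that] by auto
  have add: "slice n M k l (X + Y) = slice n M k l X + slice n M k l Y"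
    if "X \<in> carrier_mat (n * M) (n * M)" "Y \<in> carrier_mat (n * M) (n * M)" "k < M" "l < M" for X Y k l
    using that by (intro eq_matI) (auto simp: slice_def index_join)
  have smult: "slice n M k l (c \<cdot>\<^sub>m X) = c \<cdot>\<^sub>m slice n M k l X"
    if "X \<in> carrier_mat (n * M) (n * M)" "k < M" "l < M" for c X k l
    using that by (intro eq_matI) (auto simp: slice_def index_join)
  have lin: "\<And>A B. A \<in> carrier_mat n n \<Longrightarrow> B \<in> carrier_mat n n \<Longrightarrow> F (A + B) = F A + F B"
       "\<And>c A. A \<in> carrier_mat n n \<Longrightarrow> F (c \<cdot>\<^sub>m A) = c \<cdot>\<^sub>m F A"
    using F by (auto simp: superoperator_def)
  show ?thesis
    unfolding superoperator_def
  proof (intro conjI ballI allI)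
    show "tensor_id n M F \<in> carrier_mat (n * M) (n * M) \<rightarrow>\<^sub>E carrier_mat (n * M) (n * M)"
      by (auto simp: tensor_id_def)
  next
    fix X Y :: "complex mat"
    assume X: "X \<in> carrier_mat (n * M) (n * M)" and Y: "Y \<in> carrier_mat (n * M) (n * M)"
    show "tensor_id n M F (X + Y) = tensor_id n M F X + tensor_id n M F Y"
      using X Y by (intro eq_matI) (auto simp: tensor_id_def add lin d dest!: index_bound)
  next
    fix c and X :: "complex mat"
    assume X: "X \<in> carrier_mat (n * M) (n * M)"
    show "tensor_id n M F (c \<cdot>\<^sub>m X) = c \<cdot>\<^sub>m tensor_id n M F X"
      using X by (intro eq_matI) (auto simp: tensor_id_def smult lin d dest!: index_bound)
  qed
qed

lemma mat_of_rows_list_2 [simp]: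
  "mat_of_rows_list 2 [[a, b], [c, d]] \<in> carrier_mat 2 2"
  "mat_of_rows_list 2 [[a, b], [c, d]] $$ (0, 0) = a"
  "mat_of_rows_list 2 [[a, b], [c, d]] $$ (0, Suc 0) = b"
  "mat_of_rows_list 2 [[a, b], [c, d]] $$ (Suc 0, 0) = c"
  "mat_of_rows_list 2 [[a, b], [c, d]] $$ (Suc 0, Suc 0) = d"
  by (auto simp: mat_of_rows_list_def)

lemma mat2_cases:
  assumes "A \<in> carrier_mat 2 2"
  obtains a b c d where "A = mat_of_rows_list 2 [[a, b], [c, d]]"
proof
  show "A = mat_of_rows_list 2 [[A $$ (0, 0), A $$ (0, 1)], [A $$ (1, 0), A $$ (1, 1)]]"
    using assms by (intro eq_matI) (auto simp: mat_of_rows_list_def numeral_2_eq_2 less_Suc_eq)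
qed

lemma mat2_eq_iff:
  "mat_of_rows_list 2 [[a, b], [c, d]] = mat_of_rows_list 2 [[a', b'], [c', d']] \<longleftrightarrow>
     a = a' \<and> b = b' \<and> c = c' \<and> d = d'"
  by (metis mat_of_rows_list_2(2-5))

lemma vec2_eq_iff: "vec_of_list [x, y] = vec_of_list [x', y'] \<longleftrightarrow> x = x' \<and> y = y'"
  by (metis list.inject list_vec)

lemma mat2_one: "1\<^sub>m 2 = mat_of_rows_list 2 [[1, 0], [0, 1]]"
  by (intro eq_matI) (auto simp: mat_of_rows_list_def numeral_2_eq_2 less_Suc_eq)

lemma mat2_mult:
  "mat_of_rows_list 2 [[a, b], [c, d]] * mat_of_rows_list 2 [[a', b'], [c', d']] =
     mat_of_rows_list 2 [[a * a' + b * c', a * b' + b * d'], [c * a' + d * c', c * b' + d * d']]"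
  by (intro eq_matI)
    (auto simp: mat_of_rows_list_def scalar_prod_def numeral_2_eq_2 less_Suc_eq)

lemma mat2_adjoint:
  "mat_adjoint (mat_of_rows_list 2 [[a, b], [c, d]]) =
     mat_of_rows_list 2 [[cnj a, cnj c], [cnj b, cnj d]]"
  by (intro eq_matI) (auto simp: mat_of_rows_list_def numeral_2_eq_2 less_Suc_eq)

lemma mat2_mult_vec:
  "mat_of_rows_list 2 [[a, b], [c, d]] *\<^sub>v vec_of_list [x, y] =
     vec_of_list [a * x + b * y, c * x + d * y]"
  by (intro eq_vecI)
    (auto simp: mat_of_rows_list_def vec_of_list_index scalar_prod_def numeral_2_eq_2 less_Suc_eq)

lemma vec2_simps:
  "ket 0 = vec_of_list [1, 0]" "ket 1 = vec_of_list [0, 1]" "ket (Suc 0) = vec_of_list [0, 1]"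
  "c \<cdot>\<^sub>v vec_of_list [x, y] = vec_of_list [c * x, c * y]"
  "vec_of_list [x, y] + vec_of_list [x', y'] = vec_of_list [x + x', y + y']"
  "vec_of_list [x, y] - vec_of_list [x', y'] = vec_of_list [x - x', y - y']"
  by (auto intro!: eq_vecI simp: vec_of_list_index numeral_2_eq_2 less_Suc_eq)

declare vec_of_list_Cons [simp del]

lemmas mat2_simps =
  mat2_eq_iff vec2_eq_iff mat2_one mat2_mult mat2_adjoint mat2_mult_vec vec2_simps

lemma Pr0_eq: "\<rho> \<in> carrier_mat 2 2 \<Longrightarrow> Pr0 \<rho> = \<rho> $$ (0, 0)"
  by (simp add: Pr0_def scalar_prod_def numeral_2_eq_2)

lemma H_gate_iff:
  "A = H_gate \<phi> \<longleftrightarrow> unitary_mat 2 A \<and>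
     A *\<^sub>v ket 0 = (1 / sqrt 2) \<cdot>\<^sub>v (ket 0 + cis \<phi> \<cdot>\<^sub>v ket 1) \<and>
     A *\<^sub>v (cis \<phi> \<cdot>\<^sub>v ket 1) = (1 / sqrt 2) \<cdot>\<^sub>v (ket 0 - cis \<phi> \<cdot>\<^sub>v ket 1)"
  (is "?l \<longleftrightarrow> ?r")
proof
  assume ?l
  have s: "complex_of_real (sqrt 2) * complex_of_real (sqrt 2) = 2"
    by (simp flip: of_real_mult)
  show ?r
    unfolding \<open>?l\<close> unitary_mat_def H_gate_def
    by (simp add: mat2_simps cis_cnj cis_mult s)
next
  assume r: ?r
  then have "A \<in> carrier_mat 2 2" by (simp add: unitary_mat_def)
  then obtain a b c d where A: "A = mat_of_rows_list 2 [[a, b], [c, d]]" by (rule mat2_cases)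
  have c: "cis (- \<phi>) = inverse (cis \<phi>)" by simp
  from r have eqs: "a * sqrt 2 = 1" "c * sqrt 2 = cis \<phi>"
    "cis \<phi> * (b * sqrt 2) = 1" "cis \<phi> * (d * sqrt 2) = cis \<phi> * (- 1)"
    unfolding A by (simp_all add: mat2_simps field_simps)
  from eqs(4) have "d * sqrt 2 = - 1" by (subst (asm) mult_cancel_left) simp
  with eqs show ?l
    unfolding A H_gate_def c by (simp add: mat2_simps field_simps)
qed

lemma NOT_gate_iff:
  "A = NOT_gate \<phi> \<longleftrightarrow> unitary_mat 2 A \<and>
     A *\<^sub>v ket 0 = cis \<phi> \<cdot>\<^sub>v ket 1 \<and>
     A *\<^sub>v (cis \<phi> \<cdot>\<^sub>v ket 1) = ket 0"
  (is "?l \<longleftrightarrow> ?r")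
proof
  assume ?l
  show ?r
    unfolding \<open>?l\<close> unitary_mat_def NOT_gate_def
    by (simp add: mat2_simps cis_cnj cis_mult)
next
  assume r: ?r
  then have "A \<in> carrier_mat 2 2" by (simp add: unitary_mat_def)
  then obtain a b c d where A: "A = mat_of_rows_list 2 [[a, b], [c, d]]" by (rule mat2_cases)
  have c: "cis (- \<phi>) = inverse (cis \<phi>)" by simp
  from r show ?l
    unfolding A NOT_gate_def c by (simp add: mat2_simps field_simps)
qed

lemma R_gate_iff:
  "A = R_gate \<alpha> \<longleftrightarrow> unitary_mat 2 A \<and>
     A *\<^sub>v ket 0 = ket 0 \<and>
     A *\<^sub>v ket 1 = cis \<alpha> \<cdot>\<^sub>v ket 1"
  (is "?l \<longleftrightarrow> ?r")
proof
  assume ?l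
  show ?r
    unfolding \<open>?l\<close> unitary_mat_def R_gate_def
    by (simp add: mat2_simps cis_cnj cis_mult)
next
  assume r: ?r
  then have "A \<in> carrier_mat 2 2" by (simp add: unitary_mat_def)
  then obtain a b c d where A: "A = mat_of_rows_list 2 [[a, b], [c, d]]" by (rule mat2_cases)
  from r show ?l
    unfolding A R_gate_def by (simp add: mat2_simps)
qed

lemma sum_nat_product:
  fixes f :: "nat \<Rightarrow> complex"
  shows "(\<Sum>p<n * M. f p) = (\<Sum>a<n. \<Sum>k<M. f (a * M + k))"
proof -
  have "(\<Sum>p<n * M. f p) = (\<Sum>a<n. sum f {a * M..<a * M + M})"
    by (rule sum.nat_group[symmetric])
  also have "\<dots> = (\<Sum>a<n. \<Sum>k<M. f (a * M + k))"
  proof (rule sum.cong[OF refl])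
    show "sum f {a * M..<a * M + M} = (\<Sum>k<M. f (a * M + k))" for a
      using sum.shift_bounds_nat_ivl[of f 0 "a * M" M] by (simp add: add.commute lessThan_atLeast0)
  qed
  finally show ?thesis .
qed

lemma index_mult_sum:
  fixes A B :: "complex mat"
  assumes "A \<in> carrier_mat n m" "B \<in> carrier_mat m l" "i < n" "j < l"
  shows "(A * B) $$ (i, j) = (\<Sum>k<m. A $$ (i, k) * B $$ (k, j))"
  using assms by (auto simp: scalar_prod_def lessThan_atLeast0 intro!: sum.cong)

lemma kron_one_index:
  assumes "A \<in> carrier_mat n n" "i < n * M" "a < n" "k < M"
  shows "kron A (1\<^sub>m M) $$ (i, a * M + k) = (if i mod M = k then A $$ (i div M, a) else 0)"
  using assms index_bound[OF assms(2)] index_join[OF assms(3,4)] by (simp add: kron_def)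

lemma kron_one_carrier: "A \<in> carrier_mat n n \<Longrightarrow> kron A (1\<^sub>m M) \<in> carrier_mat (n * M) (n * M)"
  by (auto simp: kron_def)

lemma tensor_id_conj_superop:
  assumes A: "A \<in> carrier_mat n n" and X: "X \<in> carrier_mat (n * M) (n * M)"
  shows "tensor_id n M (conj_superop A) X = kron A (1\<^sub>m M) * X * mat_adjoint (kron A (1\<^sub>m M))"
proof (intro eq_matI)
  let ?K = "kron A (1\<^sub>m M)"
  note K = kron_one_carrier[OF A, of M]
  note Ka = mat_adjoint_carrier[OF K]
  have KX: "?K * X \<in> carrier_mat (n * M) (n * M)" using K X by simp
  fix i j
  assume "i < dim_row (?K * X * mat_adjoint ?K)" "j < dim_col (?K * X * mat_adjoint ?K)"
  then have ij: "i < n * M" "j < n * M" using K by auto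
  then have b: "i div M < n" "i mod M < M" "j div M < n" "j mod M < M"
    using index_bound by blast+
  let ?s = "slice n M (i mod M) (j mod M) X"
  have KXi: "(?K * X) $$ (i, q) = (\<Sum>a<n. A $$ (i div M, a) * X $$ (a * M + i mod M, q))"
    if q: "q < n * M" for q
  proof -
    have "(?K * X) $$ (i, q) = (\<Sum>a<n. \<Sum>k<M. ?K $$ (i, a * M + k) * X $$ (a * M + k, q))"
      using index_mult_sum[OF K X ij(1) q] by (simp add: sum_nat_product)
    also have "\<dots> = (\<Sum>a<n. \<Sum>k<M. if i mod M = k then A $$ (i div M, a) * X $$ (a * M + k, q) else 0)"
      by (intro sum.cong refl) (simp add: kron_one_index[OF A ij(1)])
    finally show ?thesis using b by simp
  qed
  have Kaj: "mat_adjoint ?K $$ (a * M + k, j) = (if j mod M = k then cnj (A $$ (j div M, a)) else 0)"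
    if "a < n" "k < M" for a k
    using K ij that by (simp add: kron_one_index[OF A ij(2)] index_join)
  have "(?K * X * mat_adjoint ?K) $$ (i, j) =
      (\<Sum>a<n. \<Sum>k<M. (?K * X) $$ (i, a * M + k) * mat_adjoint ?K $$ (a * M + k, j))"
    using index_mult_sum[OF KX Ka ij] by (simp add: sum_nat_product)
  also have "\<dots> = (\<Sum>a<n. \<Sum>k<M. if j mod M = k then
      (?K * X) $$ (i, a * M + k) * cnj (A $$ (j div M, a)) else 0)"
    by (intro sum.cong refl) (simp add: Kaj)
  also have "\<dots> = (\<Sum>a<n. (?K * X) $$ (i, a * M + j mod M) * cnj (A $$ (j div M, a)))"
    using b by simp
  also have "\<dots> = (\<Sum>a<n. (A * ?s) $$ (i div M, a) * mat_adjoint A $$ (a, j div M))"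
  proof (intro sum.cong refl)
    fix a assume "a \<in> {..<n}"
    then have a: "a < n" by simp
    have "(A * ?s) $$ (i div M, a) = (\<Sum>b<n. A $$ (i div M, b) * X $$ (b * M + i mod M, a * M + j mod M))"
      using index_mult_sum[OF A slice_carrier b(1) a] a by (simp add: slice_def)
    then show "(?K * X) $$ (i, a * M + j mod M) * cnj (A $$ (j div M, a)) =
        (A * ?s) $$ (i div M, a) * mat_adjoint A $$ (a, j div M)"
      using A a b KXi[OF index_join[OF a b(4)]] by simp
  qed
  also have "\<dots> = (A * ?s * mat_adjoint A) $$ (i div M, j div M)"
    by (rule index_mult_sum[symmetric, OF _ mat_adjoint_carrier[OF A] b(1,3)]) (use A in simp)
  also have "\<dots> = tensor_id n M (conj_superop A) X $$ (i, j)"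
    using A X ij by (simp add: tensor_id_def conj_superop_def)
  finally show "tensor_id n M (conj_superop A) X $$ (i, j) = (?K * X * mat_adjoint ?K) $$ (i, j)"
    by simp
qed (use A X in \<open>auto simp: tensor_id_def kron_def\<close>)

lemma mat_adjoint_mult:
  fixes A B :: "complex mat"
  assumes A: "A \<in> carrier_mat n m" and B: "B \<in> carrier_mat m l"
  shows "mat_adjoint (A * B) = mat_adjoint B * mat_adjoint A"
proof (intro eq_matI)
  fix i j assume "i < dim_row (mat_adjoint B * mat_adjoint A)" "j < dim_col (mat_adjoint B * mat_adjoint A)"
  then have ij: "i < l" "j < n" using A B by auto
  show "mat_adjoint (A * B) $$ (i, j) = (mat_adjoint B * mat_adjoint A) $$ (i, j)"
    using ij A B index_mult_sum[OF A B ij(2,1)]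
      index_mult_sum[OF mat_adjoint_carrier[OF B] mat_adjoint_carrier[OF A] ij]
    by (simp del: index_mult_mat(1) add: mult.commute index_mult_mat(2,3))
qed (use A B in auto)

lemma mat_adjoint_adjoint: "mat_adjoint (mat_adjoint A) = A" for A :: "complex mat"
  by (intro eq_matI) auto

lemma cscalar_prod_adjoint:
  fixes A :: "complex mat"
  assumes A: "A \<in> carrier_mat n m" and v: "v \<in> carrier_vec m" and w: "w \<in> carrier_vec n"
  shows "(A *\<^sub>v v) \<bullet>c w = v \<bullet>c (mat_adjoint A *\<^sub>v w)"
proof -
  have "(A *\<^sub>v v) \<bullet>c w = (\<Sum>i<n. \<Sum>j<m. A $$ (i, j) * v $ j * cnj (w $ i))"
    using A v w by (auto simp: scalar_prod_def lessThan_atLeast0 sum_distrib_right intro!: sum.cong)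
  also have "\<dots> = (\<Sum>j<m. \<Sum>i<n. A $$ (i, j) * v $ j * cnj (w $ i))"
    by (rule sum.swap)
  also have "\<dots> = v \<bullet>c (mat_adjoint A *\<^sub>v w)"
    using A v w by (auto simp: scalar_prod_def lessThan_atLeast0 sum_distrib_left mult_ac intro!: sum.cong)
  finally show ?thesis .
qed

lemma mat_trace_mult_comm:
  assumes A: "A \<in> carrier_mat n n" and B: "B \<in> carrier_mat n n"
  shows "mat_trace (A * B) = mat_trace (B * A)"
proof -
  have "mat_trace (A * B) = (\<Sum>i<n. \<Sum>k<n. A $$ (i, k) * B $$ (k, i))"
    unfolding mat_trace_def using A index_mult_sum[OF A B]
    by (simp del: index_mult_mat(1) add: index_mult_mat(2,3))
  also have "\<dots> = (\<Sum>k<n. \<Sum>i<n. A $$ (i, k) * B $$ (k, i))"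
    by (rule sum.swap)
  also have "\<dots> = mat_trace (B * A)"
    unfolding mat_trace_def using B index_mult_sum[OF B A]
    by (simp del: index_mult_mat(1) add: index_mult_mat(2,3) mult.commute)
  finally show ?thesis .
qed

lemma density_matrix_conj:
  assumes U: "unitary_mat n U" and r: "density_matrix n \<rho>"
  shows "density_matrix n (U * \<rho> * mat_adjoint U)"
proof -
  let ?a = mat_adjoint
  from U have Uc: "U \<in> carrier_mat n n" and UU: "?a U * U = 1\<^sub>m n" by (auto simp: unitary_mat_def)
  note Ua = mat_adjoint_carrier[OF Uc]
  from r have rc: "\<rho> \<in> carrier_mat n n" and h: "?a \<rho> = \<rho>" and t: "mat_trace \<rho> = 1"
    and p: "\<And>v. v \<in> carrier_vec n \<Longrightarrow> 0 \<le> (\<rho> *\<^sub>v v) \<bullet>c v"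
    by (auto simp: density_matrix_def)
  have Ur: "U * \<rho> \<in> carrier_mat n n" and rU: "\<rho> * ?a U \<in> carrier_mat n n" using Uc rc Ua by auto
  have assoc: "U * \<rho> * ?a U = U * (\<rho> * ?a U)" by (rule assoc_mult_mat[OF Uc rc Ua])
  have "?a (U * \<rho> * ?a U) = U * \<rho> * ?a U"
    by (simp add: assoc mat_adjoint_mult[OF Uc rU] mat_adjoint_mult[OF rc Ua] mat_adjoint_adjoint h)
  moreover have "0 \<le> ((U * \<rho> * ?a U) *\<^sub>v v) \<bullet>c v" if v: "v \<in> carrier_vec n" for v
  proof -
    have av: "?a U *\<^sub>v v \<in> carrier_vec n" using Ua v by (rule mult_mat_vec_carrier)
    have rv: "\<rho> *\<^sub>v (?a U *\<^sub>v v) \<in> carrier_vec n" using rc av by (rule mult_mat_vec_carrier)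
    have "(U * \<rho> * ?a U) *\<^sub>v v = U *\<^sub>v (\<rho> *\<^sub>v (?a U *\<^sub>v v))"
      using assoc_mult_mat_vec[OF Ur Ua v] assoc_mult_mat_vec[OF Uc rc av] by simp
    then show ?thesis using cscalar_prod_adjoint[OF Uc rv v] p[OF av] by simp
  qed
  moreover have "mat_trace (U * \<rho> * ?a U) = 1"
  proof -
    have "mat_trace (U * \<rho> * ?a U) = mat_trace (\<rho> * ?a U * U)"
      unfolding assoc by (rule mat_trace_mult_comm[OF Uc rU])
    also have "\<rho> * ?a U * U = \<rho>" using assoc_mult_mat[OF rc Ua Uc] UU rc by simp
    finally show ?thesis using t by simp
  qed
  ultimately show ?thesis using Ur Ua by (simp add: density_matrix_def)
qed

lemma superoperator_conj:
  assumes A: "A \<in> carrier_mat n n"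
  shows "superoperator n (conj_superop A)"
proof -
  note Aa = mat_adjoint_carrier[OF A]
  have "A * (X + Y) * mat_adjoint A = A * X * mat_adjoint A + A * Y * mat_adjoint A"
    if "X \<in> carrier_mat n n" "Y \<in> carrier_mat n n" for X Y
    using that A Aa
      add_mult_distrib_mat[OF mult_carrier_mat[OF A that(1)] mult_carrier_mat[OF A that(2)] Aa]
    by (simp add: mult_add_distrib_mat[OF A that])
  moreover have "A * (c \<cdot>\<^sub>m X) * mat_adjoint A = c \<cdot>\<^sub>m (A * X * mat_adjoint A)"
    if "X \<in> carrier_mat n n" for c X
    using that mult_smult_assoc_mat[OF mult_carrier_mat[OF A that] Aa]
    by (simp add: mult_smult_distrib[OF A])
  ultimately show ?thesis using A Aa by (auto simp: superoperator_def conj_superop_def simp del: assoc_mult_mat)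
qed

lemma unitary_kron_one:
  assumes U: "unitary_mat n A"
  shows "unitary_mat (n * M) (kron A (1\<^sub>m M))"
proof -
  from U have A: "A \<in> carrier_mat n n" and AA: "A * mat_adjoint A = 1\<^sub>m n"
    by (auto simp: unitary_mat_def)
  let ?K = "kron A (1\<^sub>m M)"
  note K = kron_one_carrier[OF A, of M]
  have one: "1\<^sub>m (n * M) \<in> carrier_mat (n * M) (n * M)" by simp
  have sl: "slice n M k l (1\<^sub>m (n * M)) = (if k = l then 1 else 0) \<cdot>\<^sub>m 1\<^sub>m n" if "k < M" "l < M" for k l
  proof (intro eq_matI)
    fix a b assume "a < dim_row ((if k = l then 1 else 0) \<cdot>\<^sub>m 1\<^sub>m n :: complex mat)"
      "b < dim_col ((if k = l then 1 else 0) \<cdot>\<^sub>m 1\<^sub>m n :: complex mat)"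
    then have ab: "a < n" "b < n" by auto
    have "a * M + k = b * M + l \<longleftrightarrow> a = b \<and> k = l"
      using that by (metis add_right_cancel div_mult_self3 div_less add.right_neutral
          mod_mult_self3 mod_less not_less_zero add.commute)
    then show "slice n M k l (1\<^sub>m (n * M)) $$ (a, b) = ((if k = l then 1 else 0) \<cdot>\<^sub>m 1\<^sub>m n) $$ (a, b)"
      using that ab by (simp add: slice_def index_join)
  qed (auto simp: slice_def)
  have KK: "?K * mat_adjoint ?K = 1\<^sub>m (n * M)"
  proof -
    have "?K * mat_adjoint ?K = tensor_id n M (conj_superop A) (1\<^sub>m (n * M))"
      using tensor_id_conj_superop[OF A one] K by simp
    also have "\<dots> = 1\<^sub>m (n * M)"
    proof (intro eq_matI)
      fix i j assume "i < dim_row (1\<^sub>m (n * M) :: complex mat)" "j < dim_col (1\<^sub>m (n * M) :: complex mat)"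
      then have ij: "i < n * M" "j < n * M" by auto
      then have b: "i div M < n" "i mod M < M" "j div M < n" "j mod M < M"
        using index_bound by blast+
      have id: "conj_superop A (c \<cdot>\<^sub>m 1\<^sub>m n) = c \<cdot>\<^sub>m 1\<^sub>m n" for c
      proof -
        have "conj_superop A (1\<^sub>m n) = 1\<^sub>m n" using A AA by (simp add: conj_superop_def)
        then show ?thesis using superoperator_conj[OF A] by (simp add: superoperator_def)
      qed
      have "(i div M = j div M \<and> i mod M = j mod M) = (i = j)"
        by (metis div_mult_mod_eq)
      then show "tensor_id n M (conj_superop A) (1\<^sub>m (n * M)) $$ (i, j) = 1\<^sub>m (n * M) $$ (i, j)"
        using ij b by (auto simp: tensor_id_def sl id)
    qed (auto simp: tensor_id_def)
    finally show ?thesis .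
  qed
  then show ?thesis
    using K mat_mult_left_right_inverse[OF K mat_adjoint_carrier[OF K] KK]
    by (simp add: unitary_mat_def)
qed

lemma CPSO_conj_superop:
  assumes U: "unitary_mat 2 A"
  shows "CPSO (conj_superop A)"
proof -
  from U have A: "A \<in> carrier_mat 2 2" by (simp add: unitary_mat_def)
  have "density_matrix (2 * M) (tensor_id 2 M (conj_superop A) \<rho>)" if "density_matrix (2 * M) \<rho>" for M \<rho>
  proof -
    have "\<rho> \<in> carrier_mat (2 * M) (2 * M)" using that by (simp add: density_matrix_def)
    then show ?thesis
      using density_matrix_conj[OF unitary_kron_one[OF U] that] tensor_id_conj_superop[OF A] by simp
  qed
  then show ?thesis
    using superoperator_conj[OF A] superoperator_tensor_id by (auto simp: CPSO_def PSO_def)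
qed

end

theory Submission
  imports Defs
begin

text \<open>The Choi matrix of a one-qubit CPSO \<open>F\<close> is positive, so the Cauchy--Schwarz inequality
  bounds \<open>\<langle>v|F(|0\<rangle>\<langle>1|)|w\<rangle>\<close> by \<open>\<langle>v|F(|0\<rangle>\<langle>0|)|v\<rangle>\<close> and
  \<open>\<langle>w|F(|1\<rangle>\<langle>1|)|w\<rangle>\<close>. Let \<open>s\<close>, \<open>t\<close> and \<open>u\<close> be the entries \<open>00\<close>, \<open>01\<close>
  and \<open>10\<close> of \<open>F(|0\<rangle>\<langle>1|)\<close>, \<open>q\<close> the entry \<open>00\<close> of \<open>F(|1\<rangle>\<langle>1|)\<close>, and \<open>x\<close> the entry
  \<open>01\<close> of \<open>F(|0\<rangle>\<langle>0|)\<close>. The first two equations for \<open>F\<close> give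
  \<open>2 Re (x s) = 3/4 - q/2\<close> while \<open>|x|\<^sup>2 \<le> 1/4\<close> and \<open>|s|\<^sup>2 \<le> (1 - q)/2\<close>, which forces
  \<open>q = 1/2\<close> and equality in all the bounds. Hence \<open>s\<close> is the conjugate of \<open>x\<close> and
  \<open>F(|0\<rangle>\<langle>0|)\<close> is a pure state on the equator, at an angle \<open>\<phi>\<close>. Its orthogonal vector makes
  the Cauchy--Schwarz bound vanish, which yields \<open>u\<close>, and \<open>F\<^sup>2(|0\<rangle>\<langle>0|) = |0\<rangle>\<langle>0|\<close> yields
  \<open>t\<close>, so that \<open>F\<close> is the Hadamard gate for \<open>\<phi>\<close>.

  A CPSO \<open>G\<close> that fixes (or swaps) the basis states fixes (or swaps) the coherences up to some
  factor \<open>c\<close> with \<open>|c| \<le> 1\<close>. The remaining equations, measured between two Hadamard gates, read off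
  the real part of a power of \<open>c\<close> up to a phase, and a real part \<open>1\<close> leaves only \<open>1\<close>.\<close>

abbreviation mat2 :: "complex \<Rightarrow> complex \<Rightarrow> complex \<Rightarrow> complex \<Rightarrow> complex mat" where
  "mat2 a b c d \<equiv> mat_of_rows_list 2 [[a, b], [c, d]]"

section \<open>Positivity and the Cauchy-Schwarz inequality\<close>

text \<open>The form of \<open>\<rho>\<close> is nonnegative at \<open>v + z w\<close> for every
  \<open>z\<close>. Restricting \<open>z\<close> to real multiples of \<open>b\<close> gives a real
  quadratic in \<open>t\<close> whose nonnegativity is the bound.\<close>

lemma density_matrix_cauchy:
  assumes r: "density_matrix n \<rho>" and v: "v \<in> carrier_vec n" and w: "w \<in> carrier_vec n"
  shows "(cmod ((\<rho> *\<^sub>v v) \<bullet>c w))\<^sup>2 \<le> Re ((\<rho> *\<^sub>v v) \<bullet>c v) * Re ((\<rho> *\<^sub>v w) \<bullet>c w)"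
proof -
  define Q where "Q v w = (\<rho> *\<^sub>v v) \<bullet>c w" for v w
  have rc: "\<rho> \<in> carrier_mat n n" and h: "mat_adjoint \<rho> = \<rho>"
    and pos: "\<And>v. v \<in> carrier_vec n \<Longrightarrow> 0 \<le> Q v v"
    using r by (auto simp: density_matrix_def Q_def)
  have Qsum: "Q v w = (\<Sum>i<n. \<Sum>j<n. \<rho> $$ (i, j) * v $ j * cnj (w $ i))"
    if "v \<in> carrier_vec n" "w \<in> carrier_vec n" for v w
    using rc that
    by (auto simp: Q_def scalar_prod_def lessThan_atLeast0 sum_distrib_right intro!: sum.cong)
  have rij: "cnj (\<rho> $$ (i, j)) = \<rho> $$ (j, i)" if "i < n" "j < n" for i j
    using mat_adjoint_index[of j \<rho> i] h rc that by simp
  have herm: "Q w v = cnj (Q v w)"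
    unfolding Qsum[OF v w] Qsum[OF w v] cnj_sum
    by (subst sum.swap) (auto intro!: sum.cong simp: rij)
  define b where "b = Q v w"
  have cb: "cnj b = Q w v" by (simp add: b_def herm)
  define a where "a = Re (Q v v)"
  define d where "d = Re (Q w w)"
  have a: "Q v v = of_real a" "a \<ge> 0" and d: "Q w w = of_real d" "d \<ge> 0"
    using pos[OF v] pos[OF w] by (auto simp: a_def d_def less_eq_complex_def complex_eq_iff)
  have ineq: "0 \<le> a - 2 * t * (cmod b)\<^sup>2 + t\<^sup>2 * (cmod b)\<^sup>2 * d" for t :: real
  proof -
    \<comment> \<open>The factor \<open>b\<close> aligns the phases: each cross term becomes
      \<open>- t\<close> times the squared modulus of \<open>b\<close>.\<close>
    define z where "z = - of_real t * b"
    have zw: "z \<cdot>\<^sub>v w \<in> carrier_vec n" "v + z \<cdot>\<^sub>v w \<in> carrier_vec n" using v w by auto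
    have "Q (v + z \<cdot>\<^sub>v w) (v + z \<cdot>\<^sub>v w) = (\<Sum>i<n. \<Sum>j<n. \<rho> $$ (i, j) * v $ j * cnj (v $ i) +
        cnj z * (\<rho> $$ (i, j) * v $ j * cnj (w $ i)) + z * (\<rho> $$ (i, j) * w $ j * cnj (v $ i)) +
        z * cnj z * (\<rho> $$ (i, j) * w $ j * cnj (w $ i)))"
      unfolding Qsum[OF zw(2) zw(2)]
      using v w by (intro sum.cong refl) (simp add: algebra_simps)
    also have "\<dots> = Q v v + cnj z * b + z * cnj b + z * cnj z * Q w w"
      unfolding cb unfolding b_def Qsum[OF v w] Qsum[OF w v] Qsum[OF v v] Qsum[OF w w]
      by (simp only: sum.distrib sum_distrib_left)
    also have "\<dots> = of_real a - 2 * of_real t * (b * cnj b) + of_real t ^ 2 * (b * cnj b) * of_real d"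
      by (simp add: z_def a d power2_eq_square algebra_simps)
    also have "\<dots> = of_real (a - 2 * t * (cmod b)\<^sup>2 + t\<^sup>2 * (cmod b)\<^sup>2 * d)"
      by (simp only: complex_norm_square[symmetric]) simp
    finally show ?thesis using pos[OF zw(2)] by (simp add: less_eq_complex_def)
  qed
  have "(cmod b)\<^sup>2 \<le> a * d"
  proof (cases "d = 0")
    case True
    have "(cmod b)\<^sup>2 = 0"
    proof (rule ccontr)
      assume nz: "(cmod b)\<^sup>2 \<noteq> 0"
      \<comment> \<open>At this \<open>t\<close> the inequality reads
        \<open>0 \<le> a - 2 * (a + 1)\<close>, which contradicts \<open>a \<ge> 0\<close>.\<close>
      show False using ineq[of "(a + 1) / (cmod b)\<^sup>2"] nz True a(2) by simp
    qed
    then show ?thesis using True by simp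
  next
    case False
    then have "d > 0" using d by simp
    have "0 \<le> a - (cmod b)\<^sup>2 / d" using ineq[of "1 / d"] False by (simp add: power2_eq_square field_simps)
    then show ?thesis using \<open>d > 0\<close> by (simp add: field_simps)
  qed
  then show ?thesis by (simp add: a_def b_def d_def Q_def)
qed

lemma density_matrix_ketbra:
  assumes v: "v \<in> carrier_vec n" and "v \<bullet>c v = 1"
  shows "density_matrix n (ketbra v v)"
  unfolding density_matrix_def
proof (intro conjI ballI)
  show "ketbra v v \<in> carrier_mat n n" using v by (auto simp: ketbra_def)
  show "mat_adjoint (ketbra v v) = ketbra v v" by (intro eq_matI) (auto simp: ketbra_def)
  show "mat_trace (ketbra v v) = 1"
    using assms by (simp add: mat_trace_def ketbra_def scalar_prod_def lessThan_atLeast0)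
next
  fix w :: "complex vec" assume w: "w \<in> carrier_vec n"
  have "ketbra v v *\<^sub>v w = (w \<bullet>c v) \<cdot>\<^sub>v v"
    using v w by (intro eq_vecI) (auto simp: ketbra_def scalar_prod_def sum_distrib_left sum_distrib_right mult_ac intro!: sum.cong)
  then have "(ketbra v v *\<^sub>v w) \<bullet>c w = (w \<bullet>c v) * (v \<bullet>c w)"
    using v w by simp
  also have "v \<bullet>c w = cnj (w \<bullet>c v)"
    using v w by (simp add: scalar_prod_def mult.commute)
  finally show "0 \<le> (ketbra v v *\<^sub>v w) \<bullet>c w"
    by (simp only: complex_norm_square[symmetric]) (simp add: less_eq_complex_def)
qed

section \<open>Complete positivity and the Choi matrix\<close>

text \<open>This is the case \<open>M = 1\<close>, where every matrix is its own only slice.\<close>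

lemma CPSO_imp_PSO:
  assumes "CPSO F"
  shows "PSO 2 F"
proof -
  from assms have S: "superoperator 2 F" and P': "\<And>M. M > 0 \<Longrightarrow> PSO (2 * M) (tensor_id 2 M F)"
    by (auto simp: CPSO_def)
  have P: "PSO 2 (tensor_id 2 1 F)" using P'[of 1] by simp
  have "slice 2 1 0 0 X = X" if "X \<in> carrier_mat 2 2" for X
    using that by (intro eq_matI) (auto simp: slice_def)
  moreover have "F X \<in> carrier_mat 2 2" if "X \<in> carrier_mat 2 2" for X
    using S that by (auto simp: superoperator_def)
  ultimately have "tensor_id 2 1 F X = F X" if "X \<in> carrier_mat 2 2" for X
    using that by (intro eq_matI) (simp_all add: tensor_id_def carrier_matD[of "F X" 2 2])
  then have "tensor_id 2 1 F X = F X" if "density_matrix 2 X" for X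
    using that by (simp add: density_matrix_def)
  then show ?thesis using S P by (simp add: PSO_def)
qed

text \<open>\<open>J\<close> is the normalized Choi matrix of \<open>F\<close>, with the reference system as the second
  tensor factor.\<close>

lemma CPSO_choi:
  assumes "CPSO F"
  obtains J where "density_matrix 4 J"
    "\<And>a b k l. a < 2 \<Longrightarrow> b < 2 \<Longrightarrow> k < 2 \<Longrightarrow> l < 2 \<Longrightarrow>
      J $$ (a * 2 + k, b * 2 + l) = F (ketbra (ket k) (ket l)) $$ (a, b) / 2"
proof -
  \<comment> \<open>The maximally entangled state: the indices 0 and 3 belong to the basis vectors
    00 and 11. The slices of its projector are the halved matrix units.\<close>
  define w :: "complex vec" where "w = vec 4 (\<lambda>i. if i = 0 \<or> i = 3 then 1 / sqrt 2 else 0)"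
  have s2: "complex_of_real (sqrt 2) * complex_of_real (sqrt 2) = 2"
    by (simp flip: of_real_mult)
  have "w \<bullet>c w = 1"
    by (simp add: w_def scalar_prod_def eval_nat_numeral s2)
  then have "density_matrix (2 * 2) (ketbra w w)"
    using density_matrix_ketbra[of w 4] by (simp add: w_def)
  moreover have "PSO (2 * 2) (tensor_id 2 2 F)" and S: "superoperator 2 F"
    using assms by (simp_all only: CPSO_def zero_less_numeral)
  ultimately have J: "density_matrix 4 (tensor_id 2 2 F (ketbra w w))"
    by (simp add: PSO_def)
  have "tensor_id 2 2 F (ketbra w w) $$ (a * 2 + k, b * 2 + l) = F (ketbra (ket k) (ket l)) $$ (a, b) / 2"
    if "a < 2" "b < 2" "k < 2" "l < 2" for a b k l
  proof -
    have K: "ketbra w w \<in> carrier_mat (2 * 2) (2 * 2)" "ketbra (ket k) (ket l) \<in> carrier_mat 2 2"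
      by (auto simp: ketbra_def w_def)
    then have F: "F (ketbra (ket k) (ket l)) \<in> carrier_mat 2 2"
      using S by (auto simp: superoperator_def)
    have "slice 2 2 k l (ketbra w w) = (1 / 2) \<cdot>\<^sub>m ketbra (ket k) (ket l)"
      using that by (intro eq_matI) (auto simp: slice_def ketbra_def w_def s2 less_2_cases_iff)
    moreover have "F ((1 / 2) \<cdot>\<^sub>m ketbra (ket k) (ket l)) = (1 / 2) \<cdot>\<^sub>m F (ketbra (ket k) (ket l))"
      using S K by (simp add: superoperator_def)
    moreover have "a * 2 + k < 2 * 2" "b * 2 + l < 2 * 2"
      using index_join that by blast+
    ultimately show ?thesis
      using that K F by (simp add: tensor_id_def)
  qed
  then show thesis using J that by blast
qed

text \<open>Cauchy-Schwarz for the Choi matrix at the product vectors of \<open>w\<close> with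
  \<open>ket 1\<close> and of \<open>v\<close> with \<open>ket 0\<close>. The normalizing factors
  1/2 cancel.\<close>

lemma CPSO_cauchy:
  assumes F: "CPSO F" and v: "v \<in> carrier_vec 2" and w: "w \<in> carrier_vec 2"
  shows "(cmod ((F (ketbra (ket 0) (ket 1)) *\<^sub>v w) \<bullet>c v))\<^sup>2 \<le>
    Re ((F (ketbra (ket 0) (ket 0)) *\<^sub>v v) \<bullet>c v) * Re ((F (ketbra (ket 1) (ket 1)) *\<^sub>v w) \<bullet>c w)"
proof -
  obtain J where J: "density_matrix 4 J" and Ji:
    "\<And>a b k l. a < 2 \<Longrightarrow> b < 2 \<Longrightarrow> k < 2 \<Longrightarrow> l < 2 \<Longrightarrow>
      J $$ (a * 2 + k, b * 2 + l) = F (ketbra (ket k) (ket l)) $$ (a, b) / 2"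
    using CPSO_choi[OF F] by metis
  \<comment> \<open>The tensor product of \<open>v\<close> with the basis vector
    \<open>ket k\<close> of the reference system.\<close>
  define e where "e k v = vec (2 * 2) (\<lambda>i. if i mod 2 = k then v $ (i div 2) else 0)"
    for k and v :: "complex vec"
  have ec: "e k v \<in> carrier_vec 4" for k v by (simp add: e_def)
  have Jc: "J \<in> carrier_mat 4 4" using J by (simp add: density_matrix_def)
  have Fc: "F (ketbra (ket k) (ket l)) \<in> carrier_mat 2 2" for k l
    using F by (auto simp: CPSO_def superoperator_def ketbra_def)
  have key: "(J *\<^sub>v e l w) \<bullet>c e k v = ((F (ketbra (ket k) (ket l)) *\<^sub>v w) \<bullet>c v) / 2"
    if "k < 2" "l < 2" "v \<in> carrier_vec 2" "w \<in> carrier_vec 2" for k l v w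
  proof -
    have "(J *\<^sub>v e l w) \<bullet>c e k v = (\<Sum>i<2 * 2. \<Sum>j<2 * 2. J $$ (i, j) * e l w $ j * cnj (e k v $ i))"
      using Jc ec[of l w] ec[of k v]
      by (auto simp: scalar_prod_def lessThan_atLeast0 sum_distrib_right intro!: sum.cong)
    also have "\<dots> = (\<Sum>a<2. \<Sum>k'<2. \<Sum>b<2. \<Sum>l'<2.
        J $$ (a * 2 + k', b * 2 + l') * e l w $ (b * 2 + l') * cnj (e k v $ (a * 2 + k')))"
      unfolding sum_nat_product ..
    also have "\<dots> = (\<Sum>a<2. \<Sum>k'<2. \<Sum>b<2. \<Sum>l'<2. if k' = k then if l' = l then
        F (ketbra (ket k) (ket l)) $$ (a, b) / 2 * w $ b * cnj (v $ a) else 0 else 0)"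
      by (intro sum.cong refl) (auto simp: Ji e_def)
    also have "\<dots> = (\<Sum>a<2. \<Sum>b<2. F (ketbra (ket k) (ket l)) $$ (a, b) * w $ b * cnj (v $ a)) / 2"
      using that(1,2) by (auto simp: less_2_cases_iff numeral_2_eq_2 add_divide_distrib)
    also have "\<dots> = ((F (ketbra (ket k) (ket l)) *\<^sub>v w) \<bullet>c v) / 2"
      using Fc[of k l] that by (auto simp: scalar_prod_def lessThan_atLeast0 sum_distrib_right intro!: sum.cong)
    finally show ?thesis .
  qed
  show ?thesis
    using density_matrix_cauchy[OF J ec[of 1 w] ec[of 0 v]] v w
    by (simp add: key norm_divide power_divide mult.commute)
qed

section \<open>One-qubit states and CPSOs in coordinates\<close>

lemma mat2_add: "mat2 a b c d + mat2 a' b' c' d' = mat2 (a + a') (b + b') (c + c') (d + d')"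
  by (intro eq_matI) (auto simp: mat_of_rows_list_def numeral_2_eq_2 less_Suc_eq)

lemma mat2_smult: "k \<cdot>\<^sub>m mat2 a b c d = mat2 (k * a) (k * b) (k * c) (k * d)"
  by (intro eq_matI) (auto simp: mat_of_rows_list_def numeral_2_eq_2 less_Suc_eq)

lemma ketbra_vec_of_list:
  "ketbra (vec_of_list [a, b]) (vec_of_list [c, d]) = mat2 (a * cnj c) (a * cnj d) (b * cnj c) (b * cnj d)"
  by (intro eq_matI) (auto simp: ketbra_def mat_of_rows_list_def vec_of_list_index numeral_2_eq_2 less_Suc_eq)

lemma ketbra_ket:
  "ketbra (ket 0) (ket 0) = mat2 1 0 0 0" "ketbra (ket 0) (ket 1) = mat2 0 1 0 0"
  "ketbra (ket 1) (ket 0) = mat2 0 0 1 0" "ketbra (ket 1) (ket 1) = mat2 0 0 0 1"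
  by (simp_all only: vec2_simps ketbra_vec_of_list) simp_all

lemma vec2_cscalar: "vec_of_list [a, b] \<bullet>c vec_of_list [c, d] = a * cnj c + b * cnj d"
  by (simp add: scalar_prod_def vec_of_list_index numeral_2_eq_2)

lemma mat_trace_mat2: "mat_trace (mat2 a b c d) = a + d"
  by (simp add: mat_trace_def mat_of_rows_list_def numeral_2_eq_2)

lemma Pr0_mat2 [simp]: "Pr0 (mat2 a b c d) = a"
  by (simp add: Pr0_eq)

lemma superoperator_mat2:
  assumes "superoperator 2 F"
  shows "F (mat2 a b c d) = a \<cdot>\<^sub>m F (mat2 1 0 0 0) + b \<cdot>\<^sub>m F (mat2 0 1 0 0) +
    c \<cdot>\<^sub>m F (mat2 0 0 1 0) + d \<cdot>\<^sub>m F (mat2 0 0 0 1)"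
proof -
  have lin: "\<And>A B. A \<in> carrier_mat 2 2 \<Longrightarrow> B \<in> carrier_mat 2 2 \<Longrightarrow> F (A + B) = F A + F B"
    "\<And>k A. A \<in> carrier_mat 2 2 \<Longrightarrow> F (k \<cdot>\<^sub>m A) = k \<cdot>\<^sub>m F A"
    using assms by (auto simp: superoperator_def)
  have "mat2 a b c d = a \<cdot>\<^sub>m mat2 1 0 0 0 + b \<cdot>\<^sub>m mat2 0 1 0 0 + c \<cdot>\<^sub>m mat2 0 0 1 0 + d \<cdot>\<^sub>m mat2 0 0 0 1"
    by (simp add: mat2_add mat2_smult)
  then show ?thesis by (simp add: lin)
qed

lemma superoperator_mat2_eqI:
  assumes "superoperator 2 F" "superoperator 2 G"
    and eq: "\<And>a b c d. F (mat2 a b c d) = G (mat2 a b c d)"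
  shows "F = G"
proof (rule PiE_ext[of _ _ "\<lambda>_. carrier_mat 2 2"])
  show "F \<in> carrier_mat 2 2 \<rightarrow>\<^sub>E carrier_mat 2 2" "G \<in> carrier_mat 2 2 \<rightarrow>\<^sub>E carrier_mat 2 2"
    using assms by (auto simp: superoperator_def)
  fix X :: "complex mat" assume "X \<in> carrier_mat 2 2"
  then obtain a b c d where "X = mat2 a b c d" by (rule mat2_cases)
  then show "F X = G X" using eq by simp
qed

text \<open>Hermiticity and the trace fix the shape; the bound is Cauchy-Schwarz at the two basis
  vectors.\<close>

lemma density_matrix_2E:
  assumes r: "density_matrix 2 \<rho>"
  obtains p x where "\<rho> = mat2 (of_real p) x (cnj x) (1 - of_real p)"
    "(cmod x)\<^sup>2 \<le> p * (1 - p)"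
proof -
  have "\<rho> \<in> carrier_mat 2 2" using r by (simp add: density_matrix_def)
  then obtain a x y d where \<rho>: "\<rho> = mat2 a x y d" by (rule mat2_cases)
  have y: "y = cnj x" and d: "d = 1 - a"
    using r by (auto simp: density_matrix_def \<rho> mat2_adjoint mat2_eq_iff mat_trace_mat2 eq_diff_eq add.commute)
  have pos: "0 \<le> (\<rho> *\<^sub>v v) \<bullet>c v" if "v \<in> carrier_vec 2" for v
    using r that by (simp add: density_matrix_def)
  have kets: "vec_of_list [1, 0] \<in> carrier_vec 2" "vec_of_list [0, 1] \<in> carrier_vec 2"
    by (auto intro!: carrier_vecI)
  have a: "0 \<le> a"
    using pos[OF kets(1)] by (simp add: \<rho> mat2_mult_vec vec2_cscalar)
  then have a': "a = of_real (Re a)" by (simp add: less_eq_complex_def complex_eq_iff)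
  have "(cmod y)\<^sup>2 \<le> Re a * Re d"
    using density_matrix_cauchy[OF r kets] by (simp add: \<rho> mat2_mult_vec vec2_cscalar)
  then have "(cmod x)\<^sup>2 \<le> Re a * (1 - Re a)"
    by (simp add: y d)
  then show thesis using that[of "Re a" x] a' \<rho> y d by simp
qed

text \<open>These pure states have nonzero coherences, so trace preservation on them gives
  information about the images of the off-diagonal matrix units.\<close>

lemma density_matrix_equator:
  "density_matrix 2 (mat2 (1 / 2) (cis (- \<phi>) / 2) (cis \<phi> / 2) (1 / 2))"
proof -
  let ?v = "vec_of_list [1 / sqrt 2, cis \<phi> / sqrt 2]"
  have s2: "complex_of_real (sqrt 2) * complex_of_real (sqrt 2) = 2"
    by (simp flip: of_real_mult)
  have "?v \<bullet>c ?v = 1"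
    by (simp add: vec2_cscalar s2 cis_cnj cis_mult)
  moreover have "?v \<in> carrier_vec 2" by (auto intro!: carrier_vecI)
  ultimately show ?thesis
    using density_matrix_ketbra[of ?v 2] by (simp add: ketbra_vec_of_list s2 cis_cnj cis_mult)
qed

lemma density_matrix_basis:
  "density_matrix 2 (mat2 1 0 0 0)" "density_matrix 2 (mat2 0 0 0 1)"
proof -
  have "density_matrix 2 (ketbra v v)" if "v = vec_of_list [1, 0] \<or> v = vec_of_list [0, 1]" for v
    using that by (intro density_matrix_ketbra) (auto simp: vec2_cscalar intro!: carrier_vecI)
  from this[of "vec_of_list [1, 0]"] this[of "vec_of_list [0, 1]"] show
    "density_matrix 2 (mat2 1 0 0 0)" "density_matrix 2 (mat2 0 0 0 1)"
    by (simp_all add: ketbra_vec_of_list)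
qed

text \<open>A normal form with the images of the matrix units as parameters: Hermiticity of the Choi
  matrix ties the images of the two off-diagonal units, and these images have trace 0. The last
  inequality is \<open>CPSO_cauchy\<close> in coordinates.\<close>

lemma CPSO_mat2_E:
  assumes F: "CPSO F"
  obtains p q x y s t u where
    "\<And>a b c d. F (mat2 a b c d) =
      mat2 (a * of_real p + d * of_real q + b * s + c * cnj s)
           (a * x + d * y + b * t + c * cnj u)
           (a * cnj x + d * cnj y + b * u + c * cnj t)
           (a * (1 - of_real p) + d * (1 - of_real q) - b * s - c * cnj s)"
    "(cmod x)\<^sup>2 \<le> p * (1 - p)" "(cmod y)\<^sup>2 \<le> q * (1 - q)"
    "\<And>v v' w w'. (cmod ((s * w + t * w') * cnj v + (u * w - s * w') * cnj v'))\<^sup>2 \<le>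
      Re ((of_real p * v + x * v') * cnj v + (cnj x * v + (1 - of_real p) * v') * cnj v') *
      Re ((of_real q * w + y * w') * cnj w + (cnj y * w + (1 - of_real q) * w') * cnj w')"
proof -
  have S: "superoperator 2 F" using F by (simp add: CPSO_def)
  have Fc: "F (mat2 a b c d) \<in> carrier_mat 2 2" for a b c d
    using S by (auto simp: superoperator_def)
  have D: "density_matrix 2 (F \<rho>)" if "density_matrix 2 \<rho>" for \<rho>
    using CPSO_imp_PSO[OF F] that by (simp add: PSO_def)
  obtain p x where F0: "F (mat2 1 0 0 0) = mat2 (of_real p) x (cnj x) (1 - of_real p)"
    and p: "(cmod x)\<^sup>2 \<le> p * (1 - p)"
    using density_matrix_2E[OF D[OF density_matrix_basis(1)]] by metis
  obtain q y where F1: "F (mat2 0 0 0 1) = mat2 (of_real q) y (cnj y) (1 - of_real q)"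
    and q: "(cmod y)\<^sup>2 \<le> q * (1 - q)"
    using density_matrix_2E[OF D[OF density_matrix_basis(2)]] by metis
  obtain s t u s' where X: "F (mat2 0 1 0 0) = mat2 s t u s'" by (rule mat2_cases[OF Fc])
  obtain a b c d where Y: "F (mat2 0 0 1 0) = mat2 a b c d" by (rule mat2_cases[OF Fc])
  obtain J where J: "density_matrix 4 J" and Ji:
    "\<And>a b k l. a < 2 \<Longrightarrow> b < 2 \<Longrightarrow> k < 2 \<Longrightarrow> l < 2 \<Longrightarrow>
      J $$ (a * 2 + k, b * 2 + l) = F (ketbra (ket k) (ket l)) $$ (a, b) / 2"
    using CPSO_choi[OF F] by metis
  have Jh: "cnj (J $$ (i, j)) = J $$ (j, i)" if "i < 4" "j < 4" for i j
    using J that by (metis density_matrix_def carrier_matD mat_adjoint_index)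
  have Y': "a = cnj s" "b = cnj u" "c = cnj t" "d = cnj s'"
    using Jh[of 0 1] Ji[of 0 0 0 1] Ji[of 0 0 1 0] Jh[of 2 1] Ji[of 1 0 0 1] Ji[of 0 1 1 0]
      Jh[of 0 3] Ji[of 0 1 0 1] Ji[of 1 0 1 0] Jh[of 2 3] Ji[of 1 1 0 1] Ji[of 1 1 1 0]
    by (auto simp: ketbra_ket[simplified] X Y)
  have tr: "cis (- \<phi>) * (s + s') + cis \<phi> * (cnj s + cnj s') = 0" for \<phi>
  proof -
    have "mat_trace (F (mat2 (1 / 2) (cis (- \<phi>) / 2) (cis \<phi> / 2) (1 / 2))) = 1"
      using D[OF density_matrix_equator[of \<phi>]] unfolding density_matrix_def by blast
    moreover have "mat_trace (F (mat2 (1 / 2) (cis (- \<phi>) / 2) (cis \<phi> / 2) (1 / 2))) =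
        1 + (cis (- \<phi>) * (s + s') + cis \<phi> * (cnj s + cnj s')) / 2"
      unfolding superoperator_mat2[OF S, of "1 / 2"] F0 F1 X Y Y' mat2_add mat2_smult mat_trace_mat2
      by (simp add: diff_divide_distrib add_divide_distrib distrib_left)
    ultimately show ?thesis by simp
  qed
  have "s + s' = 0"
  proof -
    \<comment> \<open>The angles \<open>0\<close> and \<open>pi / 2\<close> give two independent
      linear equations for \<open>T\<close> and \<open>T'\<close>.\<close>
    define T T' where "T = s + s'" and "T' = cnj s + cnj s'"
    have TT: "T + T' = 0" "- \<i> * T + \<i> * T' = 0"
      using tr[of 0] tr[of "pi / 2"] by (simp_all add: T_def T'_def)
    have "2 * T = (T + T') + \<i> * (- \<i> * T + \<i> * T')"
      by (simp add: complex_eq_iff)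
    then have "2 * T = 0" by (simp only: TT mult_zero_right add_0)
    then have "T = 0" by simp
    then show ?thesis by (simp add: T_def)
  qed
  then have s': "s' = - s" by (rule minus_unique[symmetric])
  have 1: "F (mat2 a b c d) =
      mat2 (a * of_real p + d * of_real q + b * s + c * cnj s)
           (a * x + d * y + b * t + c * cnj u)
           (a * cnj x + d * cnj y + b * u + c * cnj t)
           (a * (1 - of_real p) + d * (1 - of_real q) - b * s - c * cnj s)" for a b c d
    unfolding superoperator_mat2[OF S, of a] F0 F1 X Y Y' s' mat2_add mat2_smult mat2_eq_iff
    by simp
  have "(cmod ((s * w + t * w') * cnj v + (u * w - s * w') * cnj v'))\<^sup>2 \<le>
      Re ((of_real p * v + x * v') * cnj v + (cnj x * v + (1 - of_real p) * v') * cnj v') *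
      Re ((of_real q * w + y * w') * cnj w + (cnj y * w + (1 - of_real q) * w') * cnj w')"
    for v v' w w'
  proof -
    have "vec_of_list [v, v'] \<in> carrier_vec 2" "vec_of_list [w, w'] \<in> carrier_vec 2"
      by (auto intro!: carrier_vecI)
    from CPSO_cauchy[OF F this] show ?thesis
      unfolding ketbra_ket F0 F1 X s' mat2_mult_vec vec2_cscalar
      by (simp only: mult_minus_left add_uminus_conv_diff)
  qed
  from that[OF 1 p q this] show thesis .
qed

text \<open>The equality case of \<open>Re (a * b) \<le> cmod a * cmod b\<close>; it turns saturated
  bounds into equations.\<close>

lemma eq_cnj_if_norms_le:
  assumes "(cmod a)\<^sup>2 \<le> r" "(cmod b)\<^sup>2 \<le> r" "r \<le> Re (a * b)"
  shows "a = cnj b"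
proof -
  have "(cmod (a - cnj b))\<^sup>2 = (cmod a)\<^sup>2 + (cmod b)\<^sup>2 - 2 * Re (a * b)"
    by (simp only: cmod_power2) (simp add: power2_eq_square algebra_simps)
  also have "\<dots> \<le> 0" using assms by simp
  finally show ?thesis by simp
qed

lemma cisE:
  assumes "cmod z = 1"
  obtains \<phi> where "0 \<le> \<phi>" "\<phi> < 2 * pi" "z = cis \<phi>"
proof -
  have "(Re z)\<^sup>2 + (Im z)\<^sup>2 = 1" using assms cmod_power2[of z] by simp
  from sincos_total_2pi[OF this] that show thesis
    by (metis complex_eq_iff cis.sel)
qed

section \<open>The gates in coordinates\<close>

lemma conj_superop_mat2:
  "conj_superop (mat2 e f g h) (mat2 a b c d) = mat2 e f g h * mat2 a b c d * mat_adjoint (mat2 e f g h)"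
  by (simp add: conj_superop_def carrier_matD[OF mat_of_rows_list_2(1)])

lemma conj_H_mat2:
  "conj_superop (H_gate \<phi>) (mat2 a b c d) =
    mat2 ((a + cis \<phi> * b + cis (- \<phi>) * c + d) / 2)
         ((cis (- \<phi>) * a + cis (- \<phi>) ^ 2 * c - b - cis (- \<phi>) * d) / 2)
         ((cis \<phi> * a + cis \<phi> ^ 2 * b - c - cis \<phi> * d) / 2)
         ((a - cis \<phi> * b - cis (- \<phi>) * c + d) / 2)"
proof -
  \<comment> \<open>With opaque letters the claim is polynomial algebra modulo
    \<open>r * r = 1 / 2\<close> and \<open>e * f = 1\<close>.\<close>
  define r e f where "r = 1 / complex_of_real (sqrt 2)" and "e = cis \<phi>" and "f = cis (- \<phi>)"
  have H: "H_gate \<phi> = mat2 r (r * f) (r * e) (- r)"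
    by (simp add: H_gate_def r_def e_def f_def)
  have r: "r * r = 1 / 2" by (simp add: r_def flip: of_real_mult)
  have ef: "e * f = 1" by (simp add: e_def f_def cis_mult)
  have ef': "e * (f * z) = z" for z by (simp add: ef flip: mult.assoc)
  have cnj: "cnj r = r" "cnj e = f" "cnj f = e" by (simp_all add: r_def e_def f_def cis_cnj)
  show ?thesis
    unfolding H conj_superop_mat2 mat2_adjoint mat2_mult mat2_eq_iff complex_cnj_mult complex_cnj_minus cnj
      e_def[symmetric] f_def[symmetric]
    by (simp add: algebra_simps power2_eq_square r ef ef')
qed

lemma cis_mult_mult_cis_minus: "cis t * z * cis (- t) = z" "cis (- t) * z * cis t = z"
proof -
  have "cis t * z * cis (- t) = z * (cis t * cis (- t))" "cis (- t) * z * cis t = z * (cis t * cis (- t))"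
    by (simp_all only: mult_ac)
  moreover have "cis t * cis (- t) = 1" by (simp add: cis_mult)
  ultimately show "cis t * z * cis (- t) = z" "cis (- t) * z * cis t = z" by (simp_all only: mult_1_right)
qed

lemma conj_NOT_mat2:
  "conj_superop (NOT_gate \<phi>) (mat2 a b c d) = mat2 d (cis (- \<phi>) ^ 2 * c) (cis \<phi> ^ 2 * b) a"
  unfolding NOT_gate_def conj_superop_mat2 mat2_adjoint mat2_mult mat2_eq_iff
  by (simp add: cis_cnj cis_mult_mult_cis_minus power2_eq_square)

lemma conj_R_mat2:
  "conj_superop (R_gate \<alpha>) (mat2 a b c d) = mat2 a (cis (- \<alpha>) * b) (cis \<alpha> * c) d"
  unfolding R_gate_def conj_superop_mat2 mat2_adjoint mat2_mult mat2_eq_iff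
  by (simp add: cis_cnj cis_mult_mult_cis_minus)

lemma CPSO_conj_gates:
  "CPSO (conj_superop (H_gate \<phi>))" "CPSO (conj_superop (NOT_gate \<phi>))" "CPSO (conj_superop (R_gate \<phi>))"
  using H_gate_iff NOT_gate_iff R_gate_iff by (blast intro: CPSO_conj_superop)+

lemma funpow_two: "(f ^^ 2) x = f (f x)"
  by (simp add: numeral_2_eq_2)

section \<open>The equations in \<open>F\<close> alone\<close>

lemma H_family_iff:
  assumes F: "CPSO F"
  shows "F \<in> H_family \<longleftrightarrow>
    Pr0 (F (mat2 1 0 0 0)) = 1 / 2 \<and>
    Pr0 ((F ^^ 2) (mat2 1 0 0 0)) = 1 \<and>
    Pr0 ((F ^^ 2) (mat2 0 0 0 1)) = 0"
    (is "_ \<longleftrightarrow> ?P F")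
proof
  assume "F \<in> H_family"
  then obtain \<phi> where "F = conj_superop (H_gate \<phi>)" by (auto simp: H_family_def)
  then show "?P F"
    by (simp add: funpow_two conj_H_mat2 cis_mult flip: add_divide_distrib)
next
  assume P: "?P F"
  obtain p q x y s t u where F_eq:
    "\<And>a b c d. F (mat2 a b c d) =
      mat2 (a * of_real p + d * of_real q + b * s + c * cnj s)
           (a * x + d * y + b * t + c * cnj u)
           (a * cnj x + d * cnj y + b * u + c * cnj t)
           (a * (1 - of_real p) + d * (1 - of_real q) - b * s - c * cnj s)"
    and x: "(cmod x)\<^sup>2 \<le> p * (1 - p)" and y: "(cmod y)\<^sup>2 \<le> q * (1 - q)"
    and cauchy: "\<And>v v' w w'. (cmod ((s * w + t * w') * cnj v + (u * w - s * w') * cnj v'))\<^sup>2 \<le>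
      Re ((of_real p * v + x * v') * cnj v + (cnj x * v + (1 - of_real p) * v') * cnj v') *
      Re ((of_real q * w + y * w') * cnj w + (cnj y * w + (1 - of_real q) * w') * cnj w')"
    by (rule CPSO_mat2_E[OF F]) blast
  from P have p: "p = 1 / 2"
    by (simp add: F_eq complex_eq_iff)
  \<comment> \<open>Both vectors are \<open>ket 0\<close> for the first bound and
    \<open>ket 1\<close> for the second.\<close>
  have S1: "(cmod s)\<^sup>2 \<le> q / 2" and S2: "(cmod s)\<^sup>2 \<le> (1 - q) / 2"
    using cauchy[of 1 0 1 0] cauchy[of 0 1 0 1] by (simp_all add: p)
  have x': "(cmod x)\<^sup>2 \<le> 1 / 4" using x by (simp add: p)
  from P have xs: "2 * Re (x * s) = 3 / 4 - q / 2"
    by (simp add: funpow_two F_eq complex_eq_iff p algebra_simps)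
  have q: "q = 1 / 2"
  proof -
    have "(3 / 4 - q / 2)\<^sup>2 = (2 * Re (x * s))\<^sup>2" by (simp only: xs)
    also have "\<dots> \<le> 4 * (cmod (x * s))\<^sup>2"
      by (simp only: cmod_power2 power_mult_distrib) simp
    also have "\<dots> \<le> 4 * (1 / 4 * ((1 - q) / 2))"
      unfolding norm_mult power_mult_distrib
      by (intro mult_left_mono mult_mono x' S2) auto
    \<comment> \<open>The difference of the two sides of the chain is a quarter of this
      square.\<close>
    finally have "(q - 1 / 2)\<^sup>2 \<le> 0" by (simp add: power2_eq_square algebra_simps)
    then show ?thesis by simp
  qed
  have s: "s = cnj x"
    using eq_cnj_if_norms_le[of s "1 / 4" x] S1 x' xs by (simp add: q algebra_simps)
  have xx: "x * cnj x = 1 / 4"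
    using xs by (simp add: s q complex_eq_iff)
  from P have "2 * Re (y * s) = - 1 / 2"
    by (simp add: funpow_two F_eq complex_eq_iff p q algebra_simps)
  then have y': "y = - x"
    using eq_cnj_if_norms_le[of y "1 / 4" "- s"] S1 y by (simp add: q s)
  have u: "u = 2 * cnj x ^ 2"
  proof -
    have "cmod (s - 2 * u * x) \<le> 0"
    proof -
      \<comment> \<open>The vector with entries \<open>1\<close> and \<open>- 2 * cnj x\<close> lies
        in the kernel of the image of \<open>mat2 1 0 0 0\<close>, so the Cauchy-Schwarz bound is 0
        there.\<close>
      have "of_real p * 1 + x * (- 2 * cnj x) = 0" "cnj x * 1 + (1 - of_real p) * (- 2 * cnj x) = 0"
        using xx by (simp_all add: p mult_ac)
      then show ?thesis
        using cauchy[where v = 1 and v' = "- 2 * cnj x" and w = 1 and w' = 0]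
        by (simp only:) (simp add: algebra_simps)
    qed
    then have "cnj x = 2 * u * x" by (simp add: s)
    then have "2 * cnj x * cnj x = 4 * u * (x * cnj x)" by (simp add: algebra_simps)
    then show ?thesis by (simp add: xx power2_eq_square mult.assoc)
  qed
  \<comment> \<open>A state with \<open>Pr0\<close> equal to 1 has no coherence; the vanishing entry
    01 of this one determines \<open>t\<close>.\<close>
  have "density_matrix 2 (F (F (mat2 1 0 0 0)))"
    using CPSO_imp_PSO[OF F] density_matrix_basis by (simp add: PSO_def)
  then obtain r z where rz: "F (F (mat2 1 0 0 0)) = mat2 (of_real r) z (cnj z) (1 - of_real r)"
    "(cmod z)\<^sup>2 \<le> r * (1 - r)"
    by (rule density_matrix_2E) blast
  with P have "z = 0" by (simp add: funpow_two)
  with rz have "x * t + cnj x * cnj u = 0"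
    by (simp add: F_eq mat2_eq_iff y' p algebra_simps)
  moreover have "cnj x * cnj u = 2 * (x * cnj x) * x"
    by (simp add: u power2_eq_square mult_ac)
  ultimately have "x * (t + 1 / 2) = 0"
    by (simp add: xx distrib_left)
  moreover have "x \<noteq> 0" using xx by auto
  ultimately have "t + 1 / 2 = 0" by simp
  then have t: "t = - 1 / 2" by (simp only: eq_neg_iff_add_eq_0 minus_divide_left[symmetric])
  have "(cmod (2 * cnj x))\<^sup>2 = 1"
    using arg_cong[OF xx, of cmod] by (simp add: norm_mult power2_eq_square)
  then have "cmod (2 * cnj x) = 1"
    using norm_ge_zero[of "2 * cnj x"] unfolding power2_eq_1_iff by linarith
  \<comment> \<open>\<open>H_gate \<phi>\<close> sends \<open>mat2 1 0 0 0\<close> to a state with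
    entry 10 equal to \<open>cis \<phi> / 2\<close>; matching it with \<open>cnj x\<close> fixes the
    angle.\<close>
  then obtain \<phi> where \<phi>: "0 \<le> \<phi>" "\<phi> < 2 * pi" "2 * cnj x = cis \<phi>" by (rule cisE)
  have cx: "cnj x = cis \<phi> / 2" using \<phi>(3) by (simp add: mult.commute)
  then have x: "x = cis (- \<phi>) / 2"
    by (metis cis_cnj complex_cnj_cnj complex_cnj_divide complex_cnj_numeral)
  have "F = conj_superop (H_gate \<phi>)"
  proof (rule superoperator_mat2_eqI)
    show "F (mat2 a b c d) = conj_superop (H_gate \<phi>) (mat2 a b c d)" for a b c d
      unfolding F_eq conj_H_mat2 p q s t u y' mat2_eq_iff cx
      by (simp add: x cis_cnj power2_eq_square field_simps)
  qed (use F CPSO_conj_gates in \<open>auto simp: CPSO_def\<close>)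
  then show "F \<in> H_family" using \<phi> by (auto simp: H_family_def)
qed

section \<open>Maps that fix or swap the basis states\<close>

text \<open>Here \<open>p = 1\<close> and \<open>q = 0\<close>, so both basis images are pure and
  have no coherence. Cauchy-Schwarz at pairs of basis vectors then kills \<open>s\<close> and
  \<open>u\<close> and leaves \<open>t\<close> as the factor.\<close>

lemma CPSO_fixing_basis:
  assumes G: "CPSO G" and "Pr0 (G (mat2 1 0 0 0)) = 1" "Pr0 (G (mat2 0 0 0 1)) = 0"
  obtains c where "cmod c \<le> 1" "\<And>a b d e. G (mat2 a b d e) = mat2 a (c * b) (cnj c * d) e"
proof -
  obtain p q x y s t u where G_eq:
    "\<And>a b c d. G (mat2 a b c d) =
      mat2 (a * of_real p + d * of_real q + b * s + c * cnj s)
           (a * x + d * y + b * t + c * cnj u)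
           (a * cnj x + d * cnj y + b * u + c * cnj t)
           (a * (1 - of_real p) + d * (1 - of_real q) - b * s - c * cnj s)"
    and x: "(cmod x)\<^sup>2 \<le> p * (1 - p)" and y: "(cmod y)\<^sup>2 \<le> q * (1 - q)"
    and cauchy: "\<And>v v' w w'. (cmod ((s * w + t * w') * cnj v + (u * w - s * w') * cnj v'))\<^sup>2 \<le>
      Re ((of_real p * v + x * v') * cnj v + (cnj x * v + (1 - of_real p) * v') * cnj v') *
      Re ((of_real q * w + y * w') * cnj w + (cnj y * w + (1 - of_real q) * w') * cnj w')"
    by (rule CPSO_mat2_E[OF G]) blast
  have pq: "p = 1" "q = 0" using assms(2,3) by (simp_all add: G_eq)
  have xy: "x = 0" "y = 0" using x y by (simp_all add: pq)
  have "s = 0" "u = 0" "(cmod t)\<^sup>2 \<le> 1"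
    using cauchy[of 1 0 1 0] cauchy[of 0 1 1 0] cauchy[of 1 0 0 1] by (simp_all add: pq xy)
  then show thesis
    by (intro that[of t]) (simp_all add: G_eq pq xy abs_square_le_1 algebra_simps)
qed

text \<open>As for \<open>CPSO_fixing_basis\<close>, with \<open>t\<close> and \<open>u\<close>
  exchanging roles.\<close>

lemma CPSO_swapping_basis:
  assumes G: "CPSO G" and "Pr0 (G (mat2 1 0 0 0)) = 0" "Pr0 (G (mat2 0 0 0 1)) = 1"
  obtains c where "cmod c \<le> 1" "\<And>a b d e. G (mat2 a b d e) = mat2 e (cnj c * d) (c * b) a"
proof -
  obtain p q x y s t u where G_eq:
    "\<And>a b c d. G (mat2 a b c d) =
      mat2 (a * of_real p + d * of_real q + b * s + c * cnj s)
           (a * x + d * y + b * t + c * cnj u)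
           (a * cnj x + d * cnj y + b * u + c * cnj t)
           (a * (1 - of_real p) + d * (1 - of_real q) - b * s - c * cnj s)"
    and x: "(cmod x)\<^sup>2 \<le> p * (1 - p)" and y: "(cmod y)\<^sup>2 \<le> q * (1 - q)"
    and cauchy: "\<And>v v' w w'. (cmod ((s * w + t * w') * cnj v + (u * w - s * w') * cnj v'))\<^sup>2 \<le>
      Re ((of_real p * v + x * v') * cnj v + (cnj x * v + (1 - of_real p) * v') * cnj v') *
      Re ((of_real q * w + y * w') * cnj w + (cnj y * w + (1 - of_real q) * w') * cnj w')"
    by (rule CPSO_mat2_E[OF G]) blast
  have pq: "p = 0" "q = 1" using assms(2,3) by (simp_all add: G_eq)
  have xy: "x = 0" "y = 0" using x y by (simp_all add: pq)
  have "s = 0" "t = 0" "(cmod u)\<^sup>2 \<le> 1"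
    using cauchy[of 1 0 1 0] cauchy[of 1 0 0 1] cauchy[of 0 1 1 0] by (simp_all add: pq xy)
  then show thesis
    by (intro that[of u]) (simp_all add: G_eq pq xy abs_square_le_1 algebra_simps)
qed

section \<open>The equations in both variables\<close>

text \<open>The argument is the equator state made by the first Hadamard gate, with its coherence
  scaled by \<open>c\<close>. The second gate turns the real part of \<open>c\<close> into a
  probability.\<close>

lemma Pr0_conj_H_equator:
  "Pr0 (conj_superop (H_gate \<phi>) (mat2 (1 / 2) (c * cis (- \<phi>) / 2) (cnj c * cis \<phi> / 2) (1 / 2))) =
    complex_of_real (1 / 2 + 1 / 2 * Re c)"
proof -
  have "cis \<phi> * (c * cis (- \<phi>) / 2) = c / 2" "cis (- \<phi>) * (cnj c * cis \<phi> / 2) = cnj c / 2"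
    by (simp_all add: cis_mult mult.left_commute[of "cis _"] flip: times_divide_eq_right)
  then show ?thesis
    by (simp only: conj_H_mat2 Pr0_mat2) (simp add: complex_eq_iff)
qed

lemma cis_mult_left: "cis a * (cis b * z) = cis (a + b) * z"
  by (simp add: cis_mult flip: mult.assoc)

lemma H_NOT_family_iff:
  assumes G: "CPSO G"
  shows "(F, G) \<in> H_NOT_family \<longleftrightarrow> F \<in> H_family \<and>
    Pr0 (G (mat2 1 0 0 0)) = 0 \<and> Pr0 (G (mat2 0 0 0 1)) = 1 \<and>
    Pr0 ((F \<circ> G ^^ 2 \<circ> F) (mat2 1 0 0 0)) = 1 \<and> Pr0 ((F \<circ> G \<circ> F) (mat2 1 0 0 0)) = 1"
    (is "_ \<longleftrightarrow> _ \<and> ?P")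
proof
  assume "(F, G) \<in> H_NOT_family"
  then obtain \<phi> where "\<phi> \<in> {0..<2 * pi}" "F = conj_superop (H_gate \<phi>)" "G = conj_superop (NOT_gate \<phi>)"
    by (auto simp: H_NOT_family_def)
  then show "F \<in> H_family \<and> ?P"
    by (auto simp: H_family_def funpow_two conj_H_mat2 conj_NOT_mat2 DeMoivre cis_mult cis_mult_left)
next
  assume *: "F \<in> H_family \<and> ?P"
  then obtain \<phi> where \<phi>: "\<phi> \<in> {0..<2 * pi}" and F: "F = conj_superop (H_gate \<phi>)"
    by (auto simp: H_family_def)
  obtain c where c: "cmod c \<le> 1" and G_eq: "\<And>a b d e. G (mat2 a b d e) = mat2 e (cnj c * d) (c * b) a"
    using CPSO_swapping_basis[OF G] * by metis
  \<comment> \<open>The swap also conjugates the phase of the coherence; \<open>w\<close> is the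
    resulting factor relative to the original \<open>cis (- \<phi>) / 2\<close>.\<close>
  define w where "w = cnj c * cis \<phi> ^ 2"
  have "(F \<circ> G \<circ> F) (mat2 1 0 0 0) =
      F (mat2 (1 / 2) (w * cis (- \<phi>) / 2) (cnj w * cis \<phi> / 2) (1 / 2))"
    by (simp add: F G_eq conj_H_mat2 w_def power2_eq_square cis_cnj cis_mult mult.assoc)
  then have "Re w = 1"
    using * by (simp only: F Pr0_conj_H_equator) (simp add: complex_eq_iff)
  moreover have "cmod w \<le> 1" using c by (simp add: w_def norm_mult norm_power)
  \<comment> \<open>On the closed unit disc only the point 1 has real part 1.\<close>
  ultimately have "w = 1"
    using eq_cnj_if_norms_le[of w 1 1] by (simp add: abs_square_le_1)
  then have "cnj c * cis \<phi> ^ 2 * cis (- \<phi>) ^ 2 = cis (- \<phi>) ^ 2" by (simp add: w_def)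
  then have "cnj c = cis (- \<phi>) ^ 2" by (simp add: mult.assoc cis_mult flip: power_mult_distrib)
  then have "c = cis \<phi> ^ 2"
    by (metis cis_cnj complex_cnj_cnj complex_cnj_power minus_minus)
  then have "G = conj_superop (NOT_gate \<phi>)"
    using G CPSO_conj_gates
    by (intro superoperator_mat2_eqI) (auto simp: CPSO_def G_eq conj_NOT_mat2 cis_cnj)
  then show "(F, G) \<in> H_NOT_family" using F \<phi> by (auto simp: H_NOT_family_def)
qed

lemma funpow_mat2:
  assumes "\<And>a b d e. G (mat2 a b d e) = mat2 a (c * b) (cnj c * d) e"
  shows "(G ^^ n) (mat2 a b d e) = mat2 a (c ^ n * b) (cnj (c ^ n) * d) e"
  by (induction n) (simp_all add: assms mult.assoc)

text \<open>Rationality provides a positive exponent, so that \<open>LEAST\<close> is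
  attained.\<close>

lemma rotation_order_props:
  assumes "\<alpha> / pi \<in> \<rat>"
  shows "rotation_order \<alpha> > 0" "cis \<alpha> ^ rotation_order \<alpha> = 1"
proof -
  obtain a b :: int where ab: "b > 0" "\<alpha> / pi = of_int a / of_int b"
    using assms by (rule Rats_cases')
  \<comment> \<open>Twice the denominator works: \<open>2 * b * \<alpha>\<close> equals
    \<open>a\<close> full turns.\<close>
  have "[real (nat (2 * b)) * \<alpha> = 0] (rmod (2 * pi))"
  proof -
    have "real (nat (2 * b)) * \<alpha> = 0 + of_int a * (2 * pi)"
      using ab by (simp add: field_simps)
    then show ?thesis by (simp only: add_0 rcong_mult_of_int_0_left_right)
  qed
  moreover have "nat (2 * b) > 0" using ab by simp
  ultimately have "\<exists>n. n > 0 \<and> [real n * \<alpha> = 0] (rmod (2 * pi))" by blast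
  from LeastI_ex[OF this] have n: "rotation_order \<alpha> > 0" "[real (rotation_order \<alpha>) * \<alpha> = 0] (rmod (2 * pi))"
    by (simp_all add: rotation_order_def)
  obtain k where "0 = real (rotation_order \<alpha>) * \<alpha> + of_int k * (2 * pi)"
    using n(2) unfolding rcong_altdef by blast
  then have "real (rotation_order \<alpha>) * \<alpha> = 2 * pi * of_int (- k)"
    by (simp add: eq_neg_iff_add_eq_0 mult_ac)
  then have "cis \<alpha> ^ rotation_order \<alpha> = 1" by (simp only: DeMoivre cis_multiple_2pi Ints_of_int)
  with n(1) show "rotation_order \<alpha> > 0" "cis \<alpha> ^ rotation_order \<alpha> = 1" by simp_all
qed

text \<open>The equation with exponent \<open>n\<close> puts \<open>c\<close> on the unit circle,
  and the last one gives its real part \<open>cos \<alpha>\<close>. Exactly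
  \<open>cis \<alpha>\<close> and \<open>cis (- \<alpha>)\<close> remain.\<close>

lemma H_R_family_iff:
  assumes G: "CPSO G" and n: "n > 0" "cis \<alpha> ^ n = 1"
  shows "(F, G) \<in> H_family \<times> {conj_superop (R_gate \<alpha>), conj_superop (R_gate (- \<alpha>))} \<longleftrightarrow>
    F \<in> H_family \<and>
    Pr0 (G (mat2 1 0 0 0)) = 1 \<and> Pr0 (G (mat2 0 0 0 1)) = 0 \<and>
    Pr0 ((F \<circ> G ^^ n \<circ> F) (mat2 1 0 0 0)) = 1 \<and>
    Pr0 ((F \<circ> G \<circ> F) (mat2 1 0 0 0)) = complex_of_real (1 / 2 + 1 / 2 * cos \<alpha>)"
    (is "_ \<longleftrightarrow> _ \<and> ?P")
proof -
  have Pr0_FGF: "Pr0 ((F \<circ> G ^^ k \<circ> F) (mat2 1 0 0 0)) = complex_of_real (1 / 2 + 1 / 2 * Re (c ^ k))"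
    if F: "F \<in> H_family" and "\<And>a b d e. G (mat2 a b d e) = mat2 a (c * b) (cnj c * d) e" for c k
  proof -
    obtain \<phi> where F: "F = conj_superop (H_gate \<phi>)"
      using F by (auto simp: H_family_def)
    show ?thesis
      using Pr0_conj_H_equator[of \<phi> "c ^ k"] funpow_mat2[of G c, OF that(2)] by (simp add: F conj_H_mat2)
  qed
  show ?thesis
  proof
    assume "(F, G) \<in> H_family \<times> {conj_superop (R_gate \<alpha>), conj_superop (R_gate (- \<alpha>))}"
    then obtain \<beta> where FH: "F \<in> H_family" and \<beta>: "\<beta> = \<alpha> \<or> \<beta> = - \<alpha>" "G = conj_superop (R_gate \<beta>)"
      by auto
    have G_eq: "G (mat2 a b d e) = mat2 a (cis (- \<beta>) * b) (cnj (cis (- \<beta>)) * d) e" for a b d e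
      by (simp add: \<beta>(2) conj_R_mat2 cis_cnj)
    have "cis (- \<alpha>) ^ n = 1"
      using arg_cong[OF n(2), of cnj] by (simp add: cis_cnj)
    then have "cis (- \<beta>) ^ n = 1" using \<beta>(1) n(2) by auto
    then show "F \<in> H_family \<and> ?P"
      using Pr0_FGF[OF FH G_eq, of n] Pr0_FGF[OF FH G_eq, of 1] \<beta>(1) FH by (auto simp: G_eq)
  next
    assume *: "F \<in> H_family \<and> ?P"
    then obtain c where c: "cmod c \<le> 1" and G_eq: "\<And>a b d e. G (mat2 a b d e) = mat2 a (c * b) (cnj c * d) e"
      using CPSO_fixing_basis[OF G] by metis
    have FH: "F \<in> H_family" using * by blast
    have "Re (c ^ n) = 1" and Re: "Re c = cos \<alpha>"
      using Pr0_FGF[OF FH G_eq, of n] Pr0_FGF[OF FH G_eq, of 1] * by (simp_all add: complex_eq_iff)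
    \<comment> \<open>Together with \<open>cmod c \<le> 1\<close> and \<open>n > 0\<close> this
      excludes any loss of coherence.\<close>
    then have "1 \<le> cmod c ^ n" using complex_Re_le_cmod[of "c ^ n"] by (simp add: norm_power)
    then have "cmod c = 1" using c n(1) by (metis antisym_conv2 linorder_not_le norm_ge_zero power_less_one_iff)
    then have "(Re c)\<^sup>2 + (Im c)\<^sup>2 = 1" by (simp flip: cmod_power2)
    then have "(Im c)\<^sup>2 = (sin \<alpha>)\<^sup>2" by (simp add: Re sin_squared_eq)
    then have "c = cis \<alpha> \<or> c = cis (- \<alpha>)"
      by (auto simp: power2_eq_iff complex_eq_iff Re)
    \<comment> \<open>The sign is reversed because \<open>R_gate \<beta>\<close> multiplies the
      entry 01 by \<open>cis (- \<beta>)\<close>.\<close>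
    then obtain \<beta> where \<beta>: "\<beta> = \<alpha> \<or> \<beta> = - \<alpha>" "c = cis (- \<beta>)" by (metis minus_minus)
    have "G = conj_superop (R_gate \<beta>)"
      using G CPSO_conj_gates
      by (intro superoperator_mat2_eqI) (auto simp: CPSO_def G_eq conj_R_mat2 cis_cnj \<beta>(2))
    then show "(F, G) \<in> H_family \<times> {conj_superop (R_gate \<alpha>), conj_superop (R_gate (- \<alpha>))}"
      using FH \<beta>(1) by auto
  qed
qed

theorem theorem2:
  shows
    "(\<forall>F G. CPSO F \<longrightarrow> CPSO G \<longrightarrow>
        ((F, G) \<in> H_NOT_family \<longleftrightarrow>
           Pr0 (F (ketbra (ket 0) (ket 0))) = 1 / 2 \<and>
           Pr0 ((F ^^ 2) (ketbra (ket 0) (ket 0))) = 1 \<and>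
           Pr0 ((F ^^ 2) (ketbra (ket 1) (ket 1))) = 0 \<and>
           Pr0 (G (ketbra (ket 0) (ket 0))) = 0 \<and>
           Pr0 (G (ketbra (ket 1) (ket 1))) = 1 \<and>
           Pr0 ((F \<circ> G ^^ 2 \<circ> F) (ketbra (ket 0) (ket 0))) = 1 \<and>
           Pr0 ((F \<circ> G \<circ> F) (ketbra (ket 0) (ket 0))) = 1)) \<and>
     (\<forall>\<alpha> \<in> {0..pi}. \<alpha> / pi \<in> \<rat> \<longrightarrow>
        (\<forall>F G. CPSO F \<longrightarrow> CPSO G \<longrightarrow>
          ((F, G) \<in> H_family \<times> {conj_superop (R_gate \<alpha>), conj_superop (R_gate (- \<alpha>))} \<longleftrightarrow>
             Pr0 (F (ketbra (ket 0) (ket 0))) = 1 / 2 \<and>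
             Pr0 ((F ^^ 2) (ketbra (ket 0) (ket 0))) = 1 \<and>
             Pr0 ((F ^^ 2) (ketbra (ket 1) (ket 1))) = 0 \<and>
             Pr0 (G (ketbra (ket 0) (ket 0))) = 1 \<and>
             Pr0 (G (ketbra (ket 1) (ket 1))) = 0 \<and>
             Pr0 ((F \<circ> G ^^ rotation_order \<alpha> \<circ> F) (ketbra (ket 0) (ket 0))) = 1 \<and>
             Pr0 ((F \<circ> G \<circ> F) (ketbra (ket 0) (ket 0))) = complex_of_real (1 / 2 + 1 / 2 * cos \<alpha>))))"
  unfolding ketbra_ket
  \<comment> \<open>The family lemmas expand membership; \<open>conj_assoc\<close> then makes both
    sides the same conjunction.\<close>
  by (intro conjI allI ballI impI)
    (simp_all only: H_family_iff H_NOT_family_iff H_R_family_iff[OF _ rotation_order_props] conj_assoc)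

end
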